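(* Let $\mathrm{MP}[1..m]$, $m=2n+1$, be a regular feasible palindrome array. Then the lexicographically least string $x$ of scope $1$ over the integer alphabet $\{1,2,\dots\}$ such that the maximal palindrome array of $x^*$ equals $\mathrm{MP}$ can be computed in $\mathcal{O}(n)$ time.
   Context: A letter is a nonempty set of characters; letters match ($\approx$) iff they intersect. A string has scope $1$ if all its letters are single characters. A string $x$ is regular if for every tuple $(i,j_1,j_2)$ of distinct positions with $x[j_1]\approx x[i]\approx x[j_2]$ one also has $x[j_1]\approx x[j_2]$. For $x=x_1\cdots x_n$, let $x^*[1..m]=\#x_1\#x_2\#\cdots\#x_n\#$ with $m=2n+1$, where $\#$ is a new symbol matching only itself. The maximal palindrome array $\mathrm{MP}_{x^*}[1..m]$ is given by: $\mathrm{MP}_{x^*}[i]$ is the largest $r\ge0$ with $1\le i-r$, $i+r\le m$ and $x^*[i-k]\approx x^*[i+k]$ for all $1\le k\le r$. An array $\mathrm{MP}[1..m]$ ($m$ odd) is feasible if $\mathrm{MP}=0\,i_2\cdots i_{m-1}\,0$ with, for each $j\in\{2,\dots,m-1\}$, $1-(j\bmod2)\le i_j\le\min(j-1,m-j)$ and $i_j$ odd iff $j$ even. A feasible array is regular if it is the maximal palindrome array $\mathrm{MP}_{x^*}$ of some regular string $x$. *)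

theory Defs
  imports Complex_Main "HOL-Library.Landau_Symbols"
begin

section \<open>Indeterminate strings and palindrome arrays\<close>

type_synonym 'a letter = "'a set"

definition matches :: "'a letter \<Rightarrow> 'a letter \<Rightarrow> bool" (infix "\<approx>" 50) where
  "A \<approx> B \<longleftrightarrow> A \<inter> B \<noteq> {}"

definition is_string :: "'a letter list \<Rightarrow> bool" where
  "is_string x \<longleftrightarrow> (\<forall>A\<in>set x. A \<noteq> {})"

definition scope1 :: "'a letter list \<Rightarrow> bool" where
  "scope1 x \<longleftrightarrow> (\<forall>A\<in>set x. is_singleton A)"

text \<open>Positions are counted from 1.\<close>

definition nth1 :: "'b list \<Rightarrow> nat \<Rightarrow> 'b" where
  "nth1 x i = x ! (i - 1)"

definition regular :: "'a letter list \<Rightarrow> bool" where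
  "regular x \<longleftrightarrow>
     (\<forall>i\<in>{1..length x}. \<forall>j1\<in>{1..length x}. \<forall>j2\<in>{1..length x}.
        i \<noteq> j1 \<and> i \<noteq> j2 \<and> j1 \<noteq> j2 \<and> nth1 x j1 \<approx> nth1 x i \<and> nth1 x i \<approx> nth1 x j2
        \<longrightarrow> nth1 x j1 \<approx> nth1 x j2)"

text \<open>The new symbol \<open>#\<close> is the letter \<^term>\<open>{None}\<close> over the extended alphabet.\<close>

definition star :: "'a letter list \<Rightarrow> 'a option letter list" where
  "star x = {None} # concat (map (\<lambda>A. [Some ` A, {None}]) x)"

definition max_radius :: "'a letter list \<Rightarrow> nat \<Rightarrow> nat" where
  "max_radius y i =
     Max {r. 1 \<le> i - r \<and> i + r \<le> length y \<and> (\<forall>k\<in>{1..r}. nth1 y (i - k) \<approx> nth1 y (i + k))}"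

definition max_pal_array :: "'a letter list \<Rightarrow> nat list" where
  "max_pal_array y = map (max_radius y) [1..<length y + 1]"

definition feasible :: "nat list \<Rightarrow> bool" where
  "feasible MP \<longleftrightarrow>
     (let m = length MP in
        odd m \<and> nth1 MP 1 = 0 \<and> nth1 MP m = 0 \<and>
        (\<forall>j\<in>{2..m - 1}.
           1 - (j mod 2) \<le> nth1 MP j \<and> nth1 MP j \<le> min (j - 1) (m - j) \<and>
           (odd (nth1 MP j) \<longleftrightarrow> even j)))"

text \<open>
  Taking the characters of the witnessing regular string to be natural numbers is no
  restriction; see \<open>regular_string_over_nat\<close> below.
\<close>

definition regular_array :: "nat list \<Rightarrow> bool" where
  "regular_array MP \<longleftrightarrow>
     feasible MP \<and>
     (\<exists>x :: nat letter list. is_string x \<and> regular x \<and> max_pal_array (star x) = MP)"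

definition scope1_solutions :: "nat list \<Rightarrow> nat letter list set" where
  "scope1_solutions MP =
     {x. scope1 x \<and> (\<forall>A\<in>set x. A \<subseteq> {1..}) \<and> max_pal_array (star x) = MP}"

definition chars :: "'a letter list \<Rightarrow> 'a list" where
  "chars x = map the_elem x"

definition lex_least :: "nat letter list \<Rightarrow> nat letter list set \<Rightarrow> bool" where
  "lex_least x S \<longleftrightarrow>
     x \<in> S \<and> (\<forall>y\<in>S. x = y \<or> (chars x, chars y) \<in> lexord less_than)"


section \<open>The word RAM\<close>

text \<open>
  Unit-cost random access machine with words of \<open>w\<close> bits. There are finitely many registers
  per program and a word-addressed memory. Addition wraps around modulo \<open>2 ^ w\<close>,
  subtraction is truncated at 0; there is no multiplication. Registers are named by
  the numbers occurring in the instructions; the program counter runs from 0, and the machine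
  halts as soon as it leaves the program.
\<close>

datatype instr =
    Const nat nat
  | Copy nat nat
  | Add nat nat nat
  | Sub nat nat nat
  | Load nat nat
  | Store nat nat
  | Jump nat
  | JumpEq nat nat nat
  | JumpLess nat nat nat

type_synonym config = "nat \<times> (nat \<Rightarrow> nat) \<times> (nat \<Rightarrow> nat)"

fun exec :: "nat \<Rightarrow> instr \<Rightarrow> config \<Rightarrow> config" where
  "exec w (Const r k) (pc, R, M) = (pc + 1, R(r := k mod 2 ^ w), M)"
| "exec w (Copy r s) (pc, R, M) = (pc + 1, R(r := R s), M)"
| "exec w (Add r s t) (pc, R, M) = (pc + 1, R(r := (R s + R t) mod 2 ^ w), M)"
| "exec w (Sub r s t) (pc, R, M) = (pc + 1, R(r := R s - R t), M)"
| "exec w (Load r s) (pc, R, M) = (pc + 1, R(r := M (R s)), M)"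
| "exec w (Store r s) (pc, R, M) = (pc + 1, R, M(R r := R s))"
| "exec w (Jump l) (pc, R, M) = (l, R, M)"
| "exec w (JumpEq r s l) (pc, R, M) = (if R r = R s then l else pc + 1, R, M)"
| "exec w (JumpLess r s l) (pc, R, M) = (if R r < R s then l else pc + 1, R, M)"

definition halted :: "instr list \<Rightarrow> config \<Rightarrow> bool" where
  "halted P c \<longleftrightarrow> length P \<le> fst c"

definition step :: "nat \<Rightarrow> instr list \<Rightarrow> config \<Rightarrow> config" where
  "step w P c = (if halted P c then c else exec w (P ! fst c) c)"

text \<open>
  An array is stored in the memory cells 1, 2, ..., its length in register 0. All other
  registers and cells are 0 initially and irrelevant at the end.
\<close>

definition init_config :: "nat list \<Rightarrow> config" where
  "init_config xs =
     (0, (\<lambda>r. if r = 0 then length xs else 0),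
         (\<lambda>a. if a \<in> {1..length xs} then nth1 xs a else 0))"

definition holds_output :: "config \<Rightarrow> nat list \<Rightarrow> bool" where
  "holds_output c ys \<longleftrightarrow>
     (case c of (pc, R, M) \<Rightarrow> R 0 = length ys \<and> (\<forall>a\<in>{1..length ys}. M a = nth1 ys a))"

definition outputs_within :: "nat \<Rightarrow> instr list \<Rightarrow> nat list \<Rightarrow> nat list \<Rightarrow> nat \<Rightarrow> bool" where
  "outputs_within w P xs ys t \<longleftrightarrow>
     (\<exists>k\<le>t. let c = (step w P ^^ k) (init_config xs) in halted P c \<and> holds_output c ys)"


section \<open>Independence of the alphabet\<close>

lemma length_star: "length (star x) = 2 * length x + 1"
  by (induction x) (auto simp: star_def)

lemma nth_star:
  "k < 2 * length x + 1 \<Longrightarrow>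
    star x ! k = (if even k then {None} else Some ` (x ! (k div 2)))"
proof (induction x arbitrary: k)
  case Nil
  then show ?case by (simp add: star_def)
next
  case (Cons A x)
  have eq: "star (A # x) = {None} # (Some ` A) # star x"
    by (simp add: star_def)
  consider "k = 0" | "k = 1" | l where "k = Suc (Suc l)"
    by (metis One_nat_def not0_implies_Suc)
  then show ?case
    using Cons by cases (auto simp: eq)
qed

lemma max_pal_array_cong:
  assumes len: "length x = length y"
    and m: "\<And>i j. i < length x \<Longrightarrow> j < length x \<Longrightarrow> x ! i \<approx> x ! j \<longleftrightarrow> y ! i \<approx> y ! j"
  shows "max_pal_array (star x) = max_pal_array (star y)"
proof -
  have *: "star x ! k \<approx> star x ! l \<longleftrightarrow> star y ! k \<approx> star y ! l"
    if "k < 2 * length x + 1" "l < 2 * length x + 1" for k l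
  proof (cases "odd k \<and> odd l")
    case True
    have "k div 2 < length x" "l div 2 < length x"
      using that True by presburger+
    then have "x ! (k div 2) \<approx> x ! (l div 2) \<longleftrightarrow> y ! (k div 2) \<approx> y ! (l div 2)"
      by (rule m)
    then show ?thesis
      using that True len by (simp add: nth_star matches_def image_Int[symmetric])
  next
    case False
    then show ?thesis
      using that len by (auto simp: nth_star matches_def)
  qed
  have "max_radius (star x) i = max_radius (star y) i" for i
  proof -
    have "{r. 1 \<le> i - r \<and> i + r \<le> length (star x) \<and>
              (\<forall>k\<in>{1..r}. nth1 (star x) (i - k) \<approx> nth1 (star x) (i + k))} =
          {r. 1 \<le> i - r \<and> i + r \<le> length (star y) \<and>
              (\<forall>k\<in>{1..r}. nth1 (star y) (i - k) \<approx> nth1 (star y) (i + k))}"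
      unfolding nth1_def length_star len[symmetric]
      by (intro Collect_cong conj_cong refl ball_cong *) auto
    then show ?thesis
      by (simp only: max_radius_def)
  qed
  then show ?thesis
    by (simp add: max_pal_array_def length_star len)
qed

lemma regular_string_over_nat:
  fixes x :: "'a letter list"
  assumes "is_string x" "regular x"
  shows "\<exists>y :: nat letter list. is_string y \<and> scope1 y \<and> regular y \<and>
           max_pal_array (star y) = max_pal_array (star x)"
proof -
  define f where "f i = (LEAST j. j < length x \<and> x ! j \<approx> x ! i)" for i
  define y where "y = map (\<lambda>i. {f i}) [0..<length x]"
  have len: "length y = length x"
    by (simp add: y_def)
  have refl: "x ! i \<approx> x ! i" if "i < length x" for i
    using assms(1) that by (auto simp: is_string_def matches_def)
  have sym: "B \<approx> A" if "A \<approx> B" for A B :: "'c letter"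
    using that by (auto simp: matches_def)
  have trans: "x ! i \<approx> x ! k"
    if "i < length x" "j < length x" "k < length x" "x ! i \<approx> x ! j" "x ! j \<approx> x ! k" for i j k
  proof (cases "i = j \<or> j = k \<or> i = k")
    case True
    then show ?thesis using that refl by auto
  next
    case False
    have "nth1 x (Suc i) \<approx> nth1 x (Suc k)"
      using assms(2)[unfolded regular_def, rule_format, of "Suc j" "Suc i" "Suc k"] that False
      by (auto simp: nth1_def)
    then show ?thesis by (simp add: nth1_def)
  qed
  have f: "f i < length x \<and> x ! f i \<approx> x ! i" if "i < length x" for i
    unfolding f_def by (rule LeastI[where k = i]) (use that refl in auto)
  have f_iff: "f i = f j \<longleftrightarrow> x ! i \<approx> x ! j" if ij: "i < length x" "j < length x" for i j
  proof
    assume "f i = f j"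
    then show "x ! i \<approx> x ! j"
      using f[OF ij(1)] f[OF ij(2)] ij trans sym by metis
  next
    assume "x ! i \<approx> x ! j"
    then have "(l < length x \<and> x ! l \<approx> x ! i) = (l < length x \<and> x ! l \<approx> x ! j)" for l
      using ij trans sym by blast
    then show "f i = f j"
      by (simp add: f_def)
  qed
  have m: "y ! i \<approx> y ! j \<longleftrightarrow> x ! i \<approx> x ! j" if "i < length x" "j < length x" for i j
    using that by (auto simp: y_def f_iff[symmetric] matches_def[of "{_}"])
  have "is_string y" "scope1 y"
    by (auto simp: is_string_def scope1_def y_def)
  moreover have "regular y"
    unfolding regular_def nth1_def len by (auto simp: y_def matches_def)
  moreover have "max_pal_array (star y) = max_pal_array (star x)"
    by (rule max_pal_array_cong) (simp_all add: len m)
  ultimately show ?thesis by blast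
qed

end

theory Submission
  imports Defs
begin

text \<open>
  Let \<open>z\<close> be the characters of a scope-1 string with the given array. A string \<open>y\<close> has the same
  array iff \<open>y a = y b \<longleftrightarrow> z a = z b\<close> whenever the part of \<open>z\<close> strictly between \<open>a < b\<close> is a
  palindrome. The greedy string copies position \<open>p\<close> from its mirror image in some palindrome
  whose right half contains \<open>p\<close>, and if there is none takes the least character different
  from those immediately before the maximal palindromes that end at \<open>p - 1\<close>. The copying is
  forced in every solution, so the greedy string is the lexicographically least one as soon as
  it is a solution.

  For linear time, let \<open>c\<close> be the leftmost centre whose palindrome reaches \<open>p\<close>. It only moves
  to the right as \<open>p\<close> grows, and every maximal palindrome ending at \<open>p - 1\<close> is met while
  \<open>c\<close> advances at \<open>p\<close>. Hence the excluded characters can be stamped with \<open>2 * p\<close> on the way,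
  and the search for the least unstamped one is paid for by the advance of \<open>c\<close>.
\<close>

section \<open>The greedy solution\<close>

text \<open>
  Centres and \<open>t\<close> are positions of \<open>star x\<close>, where the character \<open>x_p\<close> sits at \<open>2 * p\<close>, while
  \<open>f\<close> is indexed by the positions of \<open>x\<close>; so the mirror image of \<open>j\<close> in the centre \<open>c\<close> is \<open>c - j\<close>.
\<close>

definition reflects :: "(nat \<Rightarrow> 'a) \<Rightarrow> nat \<Rightarrow> nat \<Rightarrow> bool" where
  "reflects f c t \<longleftrightarrow> (\<forall>j. 2 * c \<le> t + 2 * j \<and> 2 * j \<le> t \<longrightarrow> f j = f (c - j))"

definition char_at :: "'a letter list \<Rightarrow> nat \<Rightarrow> 'a" where
  "char_at x p = the_elem (nth1 x p)"

text \<open>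
  The exclusion set may contain \<open>y 0\<close>, from a palindromic prefix of the string. It is harmless
  because \<open>y 0 = 0\<close> is not a character.
\<close>

definition greedy_at :: "(nat \<Rightarrow> nat) \<Rightarrow> (nat \<Rightarrow> nat) \<Rightarrow> nat \<Rightarrow> bool" where
  "greedy_at r y p \<longleftrightarrow>
     (\<exists>c\<in>{1..<2 * p}. 2 * p \<le> c + r c \<and> y p = y (c - p)) \<or>
     (\<forall>c\<in>{1..<2 * p}. c + r c < 2 * p) \<and>
     y p = (LEAST v. 1 \<le> v \<and> v \<notin> {y (c - p) |c. c \<in> {1..<2 * p} \<and> c + r c + 1 = 2 * p})"

section \<open>Reflections and the locality of the greedy condition\<close>

lemma reflects_mono: "reflects f c t \<Longrightarrow> s \<le> t \<Longrightarrow> reflects f c s"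
  unfolding reflects_def by auto

lemma reflects_refl: "reflects f c c"
  unfolding reflects_def
proof (intro allI impI)
  fix j assume "2 * c \<le> c + 2 * j \<and> 2 * j \<le> c"
  then have "c - j = j" by linarith
  then show "f j = f (c - j)" by simp
qed

text \<open>In \<open>star x\<close> the window around \<open>a + b\<close> that ends at
  \<open>2 * b\<close> begins at \<open>2 * a\<close>, so for \<open>a \<le> b\<close> it covers the
  characters \<open>a..b\<close>. Ending one cell earlier, as in the odd case, it covers only those
  strictly between.\<close>

lemma reflects_even: "reflects f (a + b) (2 * b) \<longleftrightarrow> (\<forall>j. a \<le> j \<and> j \<le> b \<longrightarrow> f j = f (a + b - j))"
  unfolding reflects_def by (intro iff_allI) auto

lemma reflects_odd:
  "b \<noteq> 0 \<Longrightarrow> reflects f (a + b) (2 * b - 1) \<longleftrightarrow> (\<forall>j. a < j \<and> j < b \<longrightarrow> f j = f (a + b - j))"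
proof -
  assume "b \<noteq> 0"
  then have "(2 * (a + b) \<le> 2 * b - 1 + 2 * j \<and> 2 * j \<le> 2 * b - 1) \<longleftrightarrow> a < j \<and> j < b" for j
    by arith
  then show ?thesis unfolding reflects_def by simp
qed

text \<open>The condition at \<open>p\<close> reads only \<open>y p\<close> and the values
  \<open>y (c - p)\<close> with \<open>c - p < p\<close>, so it survives writes to later
  positions.\<close>

lemma greedy_at_cong:
  assumes "\<And>j. j \<le> p \<Longrightarrow> y j = y' j"
  shows "greedy_at r y p \<longleftrightarrow> greedy_at r y' p"
proof -
  have *: "y (c - p) = y' (c - p)" if "c \<in> {1..<2 * p}" for c
    using that assms by auto
  have "{y (c - p) |c. c \<in> {1..<2 * p} \<and> c + r c + 1 = 2 * p} =
        {y' (c - p) |c. c \<in> {1..<2 * p} \<and> c + r c + 1 = 2 * p}"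
    using * by (intro Collect_cong ex_cong1) auto
  moreover have "(\<exists>c\<in>{1..<2 * p}. 2 * p \<le> c + r c \<and> y p = y (c - p)) \<longleftrightarrow>
        (\<exists>c\<in>{1..<2 * p}. 2 * p \<le> c + r c \<and> y' p = y' (c - p))"
    using * assms[of p] by (intro bex_cong) auto
  ultimately show ?thesis
    unfolding greedy_at_def using assms[of p] by simp
qed

section \<open>Maximal radii of the starred string expressed by reflections\<close>

lemma nth1_star:
  assumes "scope1 x" "1 \<le> s" "s \<le> 2 * length x + 1"
  shows "nth1 (star x) s = (if odd s then {None} else {Some (char_at x (s div 2))})"
proof -
  have s: "star x ! (s - 1) = (if even (s - 1) then {None} else Some ` (x ! ((s - 1) div 2)))"
    by (rule nth_star) (use assms in linarith)
  show ?thesis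
  proof (cases "odd s")
    case True
    then show ?thesis using assms s by (simp add: nth1_def)
  next
    case False
    then have "is_singleton (x ! (s div 2 - 1))"
      using assms by (auto simp: scope1_def elim!: evenE)
    then have "x ! (s div 2 - 1) = {char_at x (s div 2)}"
      unfolding char_at_def nth1_def by (rule is_singleton_the_elem[THEN iffD1])
    moreover have "(s - 1) div 2 = s div 2 - 1" "odd (s - 1)"
      using False assms by (auto elim!: evenE)
    ultimately show ?thesis using False s by (simp add: nth1_def)
  qed
qed

text \<open>Mirrored cells have equal parity: two odd ones both hold \<open>#\<close> and match, two
  even ones compare characters.\<close>

lemma radius_candidate_iff:
  assumes x: "scope1 x" and c: "1 \<le> c" "c \<le> 2 * length x + 1"
  shows "1 \<le> c - r \<and> c + r \<le> length (star x) \<and>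
           (\<forall>k\<in>{1..r}. nth1 (star x) (c - k) \<approx> nth1 (star x) (c + k)) \<longleftrightarrow>
         r < c \<and> c + r \<le> 2 * length x + 1 \<and> reflects (char_at x) c (c + r)"
proof -
  let ?f = "char_at x"
  have m: "nth1 (star x) (c - k) \<approx> nth1 (star x) (c + k) \<longleftrightarrow>
        odd (c - k) \<or> ?f ((c - k) div 2) = ?f ((c + k) div 2)"
    if "k < c" "c + k \<le> 2 * length x + 1" for k
  proof -
    have "odd (c - k) \<longleftrightarrow> odd (c + k)" using that by presburger
    then show ?thesis using that x by (auto simp: nth1_star matches_def)
  qed
  have "(\<forall>k\<in>{1..r}. nth1 (star x) (c - k) \<approx> nth1 (star x) (c + k)) \<longleftrightarrow> reflects ?f c (c + r)"
    if r: "r < c" "c + r \<le> 2 * length x + 1"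
  proof
    assume L: "\<forall>k\<in>{1..r}. nth1 (star x) (c - k) \<approx> nth1 (star x) (c + k)"
    \<comment> \<open>A character left of the centre is compared at the distance
      \<open>k = c - 2 * j\<close>; the right half follows by mirroring.\<close>
    have *: "?f j = ?f (c - j)" if "2 * j < c" "c \<le> r + 2 * j" for j
    proof -
      have "c - 2 * j \<in> {1..r}" using that by auto
      with L have "nth1 (star x) (c - (c - 2 * j)) \<approx> nth1 (star x) (c + (c - 2 * j))" by blast
      moreover have "c - (c - 2 * j) = 2 * j" "(c + (c - 2 * j)) div 2 = c - j"
        using that by linarith+
      ultimately show ?thesis using m[of "c - 2 * j"] that r by simp
    qed
    show "reflects ?f c (c + r)"
      unfolding reflects_def
    proof (intro allI impI)
      fix j assume j: "2 * c \<le> c + r + 2 * j \<and> 2 * j \<le> c + r"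
      consider "2 * j < c" | "2 * j = c" | "2 * j > c" by linarith
      then show "?f j = ?f (c - j)"
      proof cases
        case 1 then show ?thesis using * j by simp
      next
        case 2 then have "c - j = j" by simp
        then show ?thesis by simp
      next
        case 3
        have "?f (c - j) = ?f (c - (c - j))" by (rule *) (use 3 j r in linarith)+
        moreover have "c - (c - j) = j" using j r by simp
        ultimately show ?thesis by simp
      qed
    qed
  next
    assume R: "reflects ?f c (c + r)"
    show "\<forall>k\<in>{1..r}. nth1 (star x) (c - k) \<approx> nth1 (star x) (c + k)"
    proof
      fix k assume k: "k \<in> {1..r}"
      show "nth1 (star x) (c - k) \<approx> nth1 (star x) (c + k)"
      proof (cases "odd (c - k)")
        case True then show ?thesis using m[of k] k r by simp
      next
        case False
        then obtain j where j: "c - k = 2 * j" by (blast elim: evenE)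
        have "?f j = ?f (c - j)"
        proof (rule R[unfolded reflects_def, rule_format])
          show "2 * c \<le> c + r + 2 * j \<and> 2 * j \<le> c + r" using j k r by auto
        qed
        moreover have "(c + k) div 2 = c - j" using j k r by auto
        ultimately show ?thesis using m[of k] j k r by simp
      qed
    qed
  qed
  then show ?thesis using c by (auto simp: length_star Suc_le_eq)
qed

text \<open>By \<open>reflects_mono\<close> the admissible radii form an initial segment, so lying
  below the maximum is the same as being admissible. The array can thus be tested at any endpoint
  \<open>t\<close>.\<close>

lemma le_max_radius_iff:
  assumes x: "scope1 x" and c: "1 \<le> c" "c \<le> 2 * length x + 1" and t: "c \<le> t"
  shows "t \<le> c + max_radius (star x) c \<longleftrightarrow>
         t < 2 * c \<and> t \<le> 2 * length x + 1 \<and> reflects (char_at x) c t"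
proof -
  define S where "S = {r. r < c \<and> c + r \<le> 2 * length x + 1 \<and> reflects (char_at x) c (c + r)}"
  have M: "max_radius (star x) c = Max S"
    unfolding max_radius_def radius_candidate_iff[OF x c] S_def ..
  have fin: "finite S" unfolding S_def by (rule finite_subset[of _ "{..<c}"]) auto
  have "0 \<in> S" using c by (simp add: S_def reflects_refl)
  then have "Max S \<in> S" using fin by (intro Max_in) auto
  have "t - c \<le> Max S \<longleftrightarrow> t - c \<in> S"
  proof
    assume "t - c \<le> Max S"
    with \<open>Max S \<in> S\<close> show "t - c \<in> S"
      by (auto simp: S_def intro: reflects_mono)
  qed (use fin in auto)
  moreover have "t - c \<in> S \<longleftrightarrow>
      t < 2 * c \<and> t \<le> 2 * length x + 1 \<and> reflects (char_at x) c t"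
    using t by (auto simp: S_def)
  ultimately show ?thesis using t unfolding M by linarith
qed

lemma nth1_max_pal_array:
  "1 \<le> c \<Longrightarrow> c \<le> length y \<Longrightarrow> nth1 (max_pal_array y) c = max_radius y c"
  by (simp add: nth1_def max_pal_array_def del: upt_Suc)

lemma mex_exists: "finite F \<Longrightarrow> \<exists>v. 1 \<le> v \<and> v \<notin> F" for F :: "nat set"
  using ex_new_if_finite[OF infinite_UNIV_nat, of "insert 0 F"]
  by (metis One_nat_def Suc_leI finite_insert insert_iff neq0_conv)

lemma mex_ge_1: "finite F \<Longrightarrow> 1 \<le> (LEAST v. 1 \<le> v \<and> v \<notin> F)" for F :: "nat set"
  using LeastI_ex[OF mex_exists] by blast

lemma mex_notin: "finite F \<Longrightarrow> (LEAST v. 1 \<le> v \<and> v \<notin> F) \<notin> F" for F :: "nat set"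
  using LeastI_ex[OF mex_exists] by blast

text \<open>
  Whether \<open>y a = y b\<close> is prescribed exactly for those \<open>a < b\<close> that enclose a palindrome.
  If \<open>b\<close> has been copied from \<open>k\<close>, then both \<open>{k..b}\<close> and the part strictly between \<open>a\<close> and
  \<open>b\<close> are palindromes; reflecting the shorter one in the longer one moves the
  prescription for \<open>(a, b)\<close> to a pair with smaller right end.
\<close>

lemma greedy_agrees:
  fixes y :: "nat \<Rightarrow> nat" and z :: "nat \<Rightarrow> 'a"
  assumes r: "\<And>c t. 1 \<le> c \<Longrightarrow> c \<le> 2 * n + 1 \<Longrightarrow> c \<le> t \<Longrightarrow>
      t \<le> c + r c \<longleftrightarrow> t < 2 * c \<and> t \<le> 2 * n + 1 \<and> reflects z c t"
    and g: "\<And>p. 1 \<le> p \<Longrightarrow> p \<le> n \<Longrightarrow> greedy_at r y p"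
  shows "b \<le> n \<Longrightarrow> 1 \<le> a \<Longrightarrow> a < b \<Longrightarrow> \<forall>j. a < j \<and> j < b \<longrightarrow> z j = z (a + b - j) \<Longrightarrow>
      y a = y b \<longleftrightarrow> z a = z b"
proof (induction b arbitrary: a rule: less_induct)
  case (less b)
  note inner = less.prems(4)[rule_format]
  have IH: "y i = y j \<longleftrightarrow> z i = z j"
    if "1 \<le> i" "i < j" "j < b" "\<And>l. i < l \<Longrightarrow> l < j \<Longrightarrow> z l = z (i + j - l)" for i j
    by (rule less.IH) (use that less.prems(1-3) in auto)
  \<comment> \<open>The condition \<open>1 \<le> k\<close> comes from \<open>t < 2 * c\<close> and
    keeps the index 0 out.\<close>
  have covers: "2 * b \<le> k + b + r (k + b) \<longleftrightarrow> (1 \<le> k \<and> (\<forall>j. k \<le> j \<and> j \<le> b \<longrightarrow> z j = z (k + b - j)))"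
    if "k < b" for k
  proof -
    have "2 * b < 2 * (k + b) \<longleftrightarrow> 1 \<le> k" "2 * b \<le> 2 * n + 1" using less.prems(1) by auto
    moreover have "2 * b \<le> k + b + r (k + b) \<longleftrightarrow>
        2 * b < 2 * (k + b) \<and> 2 * b \<le> 2 * n + 1 \<and> reflects z (k + b) (2 * b)"
      by (rule r) (use that less.prems(1-3) in auto)
    ultimately show ?thesis unfolding reflects_even by blast
  qed
  \<comment> \<open>The ends of a full palindrome that ends before \<open>b\<close> agree in
    \<open>y\<close>, because the induction hypothesis applies to its interior.\<close>
  have pal_eq: "y i = y j" if "1 \<le> i" "i < b" "j < b" "1 \<le> j"
      "\<And>l. min i j \<le> l \<Longrightarrow> l \<le> max i j \<Longrightarrow> z l = z (i + j - l)" for i j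
  proof -
    have *: "y i = y j" if ij: "1 \<le> i" "i < j" "j < b"
      and pal: "\<And>l. i \<le> l \<Longrightarrow> l \<le> j \<Longrightarrow> z l = z (i + j - l)" for i j
    proof -
      have "y i = y j \<longleftrightarrow> z i = z j"
        by (rule IH[OF ij]) (rule pal, simp_all)
      moreover have "z i = z j" using pal[of i] ij by simp
      ultimately show ?thesis by simp
    qed
    consider "i < j" | "i = j" | "j < i" by linarith
    then show ?thesis
    proof cases
      case 1
      show ?thesis by (rule *) (use 1 that(1-4) in simp_all, rule that(5), simp_all)
    next
      case 3
      have "y j = y i"
        by (rule *, use 3 that(1-4) in simp_all, subst add.commute, rule that(5), simp_all)
      then show ?thesis by simp
    qed simp
  qed
  show ?case
  proof (cases "\<exists>c\<in>{1..<2 * b}. 2 * b \<le> c + r c \<and> y b = y (c - b)")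
    case True
    then obtain c where c: "c \<in> {1..<2 * b}" "2 * b \<le> c + r c" "y b = y (c - b)" by blast
    have "b < c" using r[of c "2 * b"] c less.prems(1-3) by auto
    define k where "k = c - b"
    have k: "1 \<le> k" "k < b" "y b = y k" and "2 * b \<le> k + b + r (k + b)"
      using c \<open>b < c\<close> by (auto simp: k_def)
    then have pal: "\<And>j. k \<le> j \<Longrightarrow> j \<le> b \<Longrightarrow> z j = z (k + b - j)"
      using covers[of k] by blast
    have zk: "z b = z k" using pal[of b] k by simp
    consider "a = k" | "k < a" | "a < k" by linarith
    then show ?thesis
    proof cases
      case 1 then show ?thesis using k zk by simp
    next
      case 2
      \<comment> \<open>Mirroring in the longer palindrome \<open>{k..b}\<close> sends
        \<open>b\<close> to \<open>k\<close> and \<open>a\<close> to \<open>a'\<close>, so the pair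
        \<open>(a, b)\<close> becomes \<open>(k, a')\<close>.\<close>
      define a' where "a' = k + b - a"
      have a': "k < a'" "a' < b" using 2 less.prems(1-3) k by (auto simp: a'_def)
      have za: "z a = z a'" using pal[of a] 2 less.prems(1-3) by (simp add: a'_def)
      have "y a = y a'"
      proof (rule pal_eq)
        fix l assume "min a a' \<le> l" "l \<le> max a a'"
        then show "z l = z (a + a' - l)"
          using pal[of l] 2 a' less.prems(1-3) by (auto simp: a'_def min_def max_def split: if_splits)
      qed (use 2 a' k less.prems(1-3) in auto)
      moreover have "y k = y a' \<longleftrightarrow> z k = z a'"
      proof (rule IH)
        fix l assume l: "k < l" "l < a'"
        have "z l = z (k + b - l)" using pal[of l] l a' by simp
        also have "\<dots> = z (a + b - (k + b - l))"
          using l a' k by (intro inner) (auto simp: a'_def)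
        also have "a + b - (k + b - l) = k + b - (k + a' - l)"
          using l a' k 2 less.prems(1-3) by (auto simp: a'_def)
        also have "z \<dots> = z (k + a' - l)"
          by (rule pal[symmetric]) (use l a' in auto)
        finally show "z l = z (k + a' - l)" .
      qed (use a' k in auto)
      ultimately show ?thesis using k(3) zk za by metis
    next
      case 3
      \<comment> \<open>Now \<open>{k..b}\<close> is the shorter palindrome. Mirroring in the part
        between \<open>a\<close> and \<open>b\<close> sends \<open>k\<close> to \<open>k'\<close>,
        so \<open>y b = y k = y k'\<close> and the pair becomes \<open>(a, k')\<close>.\<close>
      define k' where "k' = a + b - k"
      have k': "a < k'" "k' < b" using 3 less.prems(1-3) k by (auto simp: k'_def)
      have zk': "z k = z k'" using inner[of k] 3 k by (simp add: k'_def)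
      have "y k = y k'"
      proof (rule pal_eq)
        fix l assume "min k k' \<le> l" "l \<le> max k k'"
        then show "z l = z (k + k' - l)"
          using inner[of l] 3 k k' less.prems(1-3) by (auto simp: k'_def min_def max_def split: if_splits)
      qed (use 3 k' k less.prems(1-3) in auto)
      moreover have "y a = y k' \<longleftrightarrow> z a = z k'"
      proof (rule IH)
        fix l assume l: "a < l" "l < k'"
        have "z l = z (a + b - l)" using inner[of l] l k' by simp
        also have "\<dots> = z (k + b - (a + b - l))"
          using l k' k by (intro pal) (auto simp: k'_def)
        also have "k + b - (a + b - l) = a + b - (a + k' - l)"
          using l k' k 3 less.prems(1-3) by (auto simp: k'_def)
        also have "z \<dots> = z (a + k' - l)"
          by (rule inner[symmetric]) (use l k' in auto)
        finally show "z l = z (a + k' - l)" .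
      qed (use k' k less.prems(1-3) in auto)
      ultimately show ?thesis using k(3) zk zk' by metis
    qed
  next
    case False
    let ?F = "{y (c - b) |c. c \<in> {1..<2 * b} \<and> c + r c + 1 = 2 * b}"
    have "greedy_at r y b" by (rule g) (use less.prems(1-3) in auto)
    with False have unc: "\<forall>c\<in>{1..<2 * b}. c + r c < 2 * b"
      and yb: "y b = (LEAST v. 1 \<le> v \<and> v \<notin> ?F)"
      unfolding greedy_at_def by blast+
    have unc_a: "a + b + r (a + b) < 2 * b"
      using unc less.prems(1-3) by (simp add: Ball_def)
    \<comment> \<open>Equality would enlarge the inner palindrome to \<open>{a..b}\<close>, which
      would cover \<open>b\<close>.\<close>
    have nz: "z a \<noteq> z b"
    proof
      assume e: "z a = z b"
      have "z j = z (a + b - j)" if "a \<le> j" "j \<le> b" for j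
        using that inner[of j] e by (cases "j = a \<or> j = b") auto
      then have "2 * b \<le> a + b + r (a + b)" using covers[of a] less.prems(1-3) by blast
      then show False using unc_a by simp
    qed
    \<comment> \<open>The inner part is a palindrome, so the maximal one centred at
      \<open>a + b\<close> stops exactly at \<open>2 * b - 1\<close> and puts \<open>y a\<close>
      into the exclusion set.\<close>
    have "2 * b - 1 \<le> a + b + r (a + b)"
      using reflects_odd[THEN iffD2, OF _ less.prems(4)] less.prems(1-3) by (subst r) auto
    then have "a + b + r (a + b) + 1 = 2 * b" using unc_a by simp
    then have ya: "y a \<in> ?F" using less.prems(1-3) by (auto intro!: exI[of _ "a + b"])
    have "finite ?F"
      by (rule finite_subset[of _ "(\<lambda>c. y (c - b)) ` {1..<2 * b}"]) auto
    then have "y b \<notin> ?F" unfolding yb by (rule mex_notin)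
    then have "y a \<noteq> y b" using ya by metis
    then show ?thesis using nz by simp
  qed
qed

section \<open>The greedy string as the least solution\<close>

lemma reflects_Suc:
  assumes "c \<le> t" "Suc t < 2 * c"
  shows "reflects f c (Suc t) \<longleftrightarrow>
         reflects f c t \<and> (even (Suc t) \<longrightarrow> f (Suc t div 2) = f (c - Suc t div 2))"
proof (intro iffI conjI impI)
  assume L: "reflects f c (Suc t)"
  then show "reflects f c t" by (rule reflects_mono) simp
  show "f (Suc t div 2) = f (c - Suc t div 2)" if "even (Suc t)"
    by (rule L[unfolded reflects_def, rule_format]) (use that assms in \<open>auto elim!: evenE\<close>)
next
  assume R: "reflects f c t \<and> (even (Suc t) \<longrightarrow> f (Suc t div 2) = f (c - Suc t div 2))"
  show "reflects f c (Suc t)"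
    unfolding reflects_def
  proof (intro allI impI)
    fix j assume j: "2 * c \<le> Suc t + 2 * j \<and> 2 * j \<le> Suc t"
    \<comment> \<open>Only the two ends of the enlarged window are new, and they mirror each
      other.\<close>
    consider "2 * j = Suc t" | "2 * c = Suc t + 2 * j" | "2 * c \<le> t + 2 * j \<and> 2 * j \<le> t"
      using j by linarith
    then show "f j = f (c - j)"
    proof cases
      case 1
      then have "Suc t = 2 * j" by simp
      then have "even (Suc t)" "Suc t div 2 = j" by simp_all
      then show ?thesis using R by metis
    next
      case 2
      then have "Suc t = 2 * (c - j)" by linarith
      then have "even (Suc t)" "Suc t div 2 = c - j" by simp_all
      moreover have "c - (c - j) = j" using 2 by linarith
      ultimately show ?thesis using R by metis
    next
      case 3
      then show ?thesis using R unfolding reflects_def by blast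
    qed
  qed
qed

lemma scope1_solution_radius:
  assumes "scope1 x" "max_pal_array (star x) = MP" "length MP = 2 * n + 1"
  shows "length x = n"
    and "1 \<le> c \<Longrightarrow> c \<le> 2 * n + 1 \<Longrightarrow> nth1 MP c = max_radius (star x) c"
    and "1 \<le> c \<Longrightarrow> c \<le> 2 * n + 1 \<Longrightarrow> c \<le> t \<Longrightarrow>
      t \<le> c + nth1 MP c \<longleftrightarrow> t < 2 * c \<and> t \<le> 2 * n + 1 \<and> reflects (char_at x) c t"
proof -
  show n: "length x = n"
    using assms by (auto simp: max_pal_array_def length_star simp del: upt_Suc)
  show r: "nth1 MP c = max_radius (star x) c" if "1 \<le> c" "c \<le> 2 * n + 1" for c
    using nth1_max_pal_array[of c "star x"] that assms n by (simp add: length_star)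
  show "t \<le> c + nth1 MP c \<longleftrightarrow> t < 2 * c \<and> t \<le> 2 * n + 1 \<and> reflects (char_at x) c t"
    if "1 \<le> c" "c \<le> 2 * n + 1" "c \<le> t"
    using le_max_radius_iff[of x c t] that assms n r by simp
qed

lemma regular_array_scope1_solution:
  assumes "regular_array MP"
  obtains x :: "nat letter list" where "scope1 x" "max_pal_array (star x) = MP"
  using assms regular_string_over_nat unfolding regular_array_def by metis

text \<open>At \<open>t = 2 * p\<close> the bound \<open>t < 2 * c\<close> gives
  \<open>p < c\<close>, so a copied character comes from a position at least 1 and never from
  \<open>y 0\<close>.\<close>

lemma greedy_ge_1:
  assumes r: "\<And>c t. 1 \<le> c \<Longrightarrow> c \<le> 2 * n + 1 \<Longrightarrow> c \<le> t \<Longrightarrow> t \<le> c + r c \<Longrightarrow> t < 2 * c"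
    and g: "\<And>p. 1 \<le> p \<Longrightarrow> p \<le> n \<Longrightarrow> greedy_at r y p"
  shows "1 \<le> p \<Longrightarrow> p \<le> n \<Longrightarrow> 1 \<le> y p"
proof (induction p rule: less_induct)
  case (less p)
  let ?F = "{y (c - p) |c. c \<in> {1..<2 * p} \<and> c + r c + 1 = 2 * p}"
  from g[OF less.prems] show ?case
    unfolding greedy_at_def
  proof (elim disjE bexE conjE)
    fix c assume c: "c \<in> {1..<2 * p}" "2 * p \<le> c + r c" "y p = y (c - p)"
    have "2 * p < 2 * c" by (rule r) (use c less.prems in auto)
    then show ?thesis using less.IH[of "c - p"] c less.prems by auto
  next
    assume "y p = (LEAST v. 1 \<le> v \<and> v \<notin> ?F)"
    moreover have "finite ?F"
      by (rule finite_subset[of _ "(\<lambda>c. y (c - p)) ` {1..<2 * p}"]) auto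
    ultimately show ?thesis using mex_ge_1[of ?F] by simp
  qed
qed

definition string_of :: "(nat \<Rightarrow> nat) \<Rightarrow> nat \<Rightarrow> nat letter list" where
  "string_of y n = map (\<lambda>p. {y p}) [1..<n + 1]"

lemma string_of_simps:
  "length (string_of y n) = n" "scope1 (string_of y n)" "chars (string_of y n) = map y [1..<n + 1]"
  "1 \<le> p \<Longrightarrow> p \<le> n \<Longrightarrow> char_at (string_of y n) p = y p"
  by (auto simp: string_of_def scope1_def chars_def char_at_def nth1_def simp del: upt_Suc)

text \<open>The bounds on \<open>t\<close> keep every compared index within
  \<open>{1..n}\<close>.\<close>

lemma reflects_cong:
  assumes "\<And>p. 1 \<le> p \<Longrightarrow> p \<le> n \<Longrightarrow> f p = g p" "t < 2 * c" "t \<le> 2 * n + 1"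
  shows "reflects f c t \<longleftrightarrow> reflects g c t"
proof -
  have "f j = f (c - j) \<longleftrightarrow> g j = g (c - j)" if "2 * c \<le> t + 2 * j \<and> 2 * j \<le> t" for j
    using assms(1)[of j] assms(1)[of "c - j"] that assms(2,3) by auto
  then show ?thesis unfolding reflects_def by blast
qed

text \<open>By \<open>greedy_agrees\<close>, a window grown cell by cell around a fixed centre meets
  its first mismatch at the same place in \<open>y\<close> as in \<open>u\<close>, so all radii
  agree.\<close>

lemma greedy_solution:
  assumes len: "length MP = 2 * n + 1"
    and u: "scope1 u" "max_pal_array (star u) = MP"
    and g: "\<And>p. 1 \<le> p \<Longrightarrow> p \<le> n \<Longrightarrow> greedy_at (nth1 MP) y p"
  shows "max_pal_array (star (string_of y n)) = MP"
proof -
  let ?x = "string_of y n"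
  note sol = scope1_solution_radius[OF u len]
  have refl_iff: "reflects y c t \<longleftrightarrow> reflects (char_at u) c t"
    if "1 \<le> c" "c \<le> t" "t < 2 * c" "t \<le> 2 * n + 1" for c t
    using that(2,3,4)
  proof (induction t rule: dec_induct)
    case base
    show ?case by (simp add: reflects_refl)
  next
    case (step t)
    have "y (Suc t div 2) = y (c - Suc t div 2) \<longleftrightarrow>
        char_at u (Suc t div 2) = char_at u (c - Suc t div 2)"
      if ev: "even (Suc t)" and R: "reflects (char_at u) c t"
    proof -
      obtain b where b: "Suc t = 2 * b" using ev by (blast elim: evenE)
      define a where "a = c - b"
      have ab: "b \<le> n" "1 \<le> a" "a < b" "c = a + b" "b \<noteq> 0"
        using b step by (auto simp: a_def)
      have "t = 2 * b - 1" using b by simp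
      then have "\<forall>j. a < j \<and> j < b \<longrightarrow> char_at u j = char_at u (a + b - j)"
        using R reflects_odd[OF ab(5)] ab(4) by blast
      then have "y a = y b \<longleftrightarrow> char_at u a = char_at u b"
        using greedy_agrees[OF sol(3) g] ab by blast
      moreover have "Suc t div 2 = b" "c - b = a" using b by (simp_all add: a_def)
      ultimately show ?thesis by metis
    qed
    moreover have "reflects y c t \<longleftrightarrow> reflects (char_at u) c t"
      using step by simp
    ultimately show ?case
      using step by (auto simp: reflects_Suc)
  qed
  have "max_radius (star ?x) c = max_radius (star u) c" if c: "1 \<le> c" "c \<le> 2 * n + 1" for c
  proof -
    have "t \<le> c + max_radius (star ?x) c \<longleftrightarrow> t \<le> c + max_radius (star u) c" if t: "c \<le> t" for t
    proof -
      have "t \<le> c + max_radius (star ?x) c \<longleftrightarrow>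
          t < 2 * c \<and> t \<le> 2 * n + 1 \<and> reflects (char_at ?x) c t"
        using le_max_radius_iff[of ?x c t] c t by (simp add: string_of_simps)
      also have "\<dots> \<longleftrightarrow> t < 2 * c \<and> t \<le> 2 * n + 1 \<and> reflects y c t"
        using reflects_cong[of n "char_at ?x" y t c] by (auto simp: string_of_simps)
      also have "\<dots> \<longleftrightarrow> t < 2 * c \<and> t \<le> 2 * n + 1 \<and> reflects (char_at u) c t"
        using refl_iff[of c t] c t by blast
      also have "\<dots> \<longleftrightarrow> t \<le> c + max_radius (star u) c"
        using sol(2,3) c t by simp
      finally show ?thesis .
    qed
    \<comment> \<open>Each endpoint, used as \<open>t\<close>, bounds the other.\<close>
    from this[of "c + max_radius (star ?x) c"] this[of "c + max_radius (star u) c"]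
    show ?thesis by simp
  qed
  then have "max_pal_array (star ?x) = max_pal_array (star u)"
    unfolding max_pal_array_def length_star string_of_simps sol(1) by (intro map_cong) auto
  then show ?thesis using u by simp
qed

text \<open>Here \<open>w\<close> stands for a competing solution that agrees with \<open>y\<close>
  before \<open>p\<close>. A copied character is forced in it, and an excluded one would prolong a
  maximal palindrome.\<close>

lemma greedy_minimal:
  assumes r: "\<And>c t. 1 \<le> c \<Longrightarrow> c \<le> 2 * n + 1 \<Longrightarrow> c \<le> t \<Longrightarrow>
      t \<le> c + r c \<longleftrightarrow> t < 2 * c \<and> t \<le> 2 * n + 1 \<and> reflects w c t"
    and w: "1 \<le> w p" and p: "1 \<le> p" "p \<le> n"
    and y0: "y 0 = 0" and g: "greedy_at r y p"
    and before: "\<And>q. 1 \<le> q \<Longrightarrow> q < p \<Longrightarrow> w q = y q"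
  shows "y p \<le> w p"
  using g unfolding greedy_at_def
proof (elim disjE bexE conjE)
  fix c assume c: "c \<in> {1..<2 * p}" "2 * p \<le> c + r c" "y p = y (c - p)"
  have cp: "p < c" and R: "reflects w c (2 * p)" using r[of c "2 * p"] c p by auto
  have "w p = w (c - p)"
    by (rule R[unfolded reflects_def, rule_format]) (use c cp in auto)
  also have "\<dots> = y (c - p)" by (rule before) (use c cp in auto)
  finally show ?thesis using c by simp
next
  let ?F = "{y (c - p) |c. c \<in> {1..<2 * p} \<and> c + r c + 1 = 2 * p}"
  assume "y p = (LEAST v. 1 \<le> v \<and> v \<notin> ?F)"
  moreover have "w p \<notin> ?F"
  proof
    assume "w p \<in> ?F"
    then obtain c where c: "c \<in> {1..<2 * p}" "c + r c + 1 = 2 * p" "w p = y (c - p)" by blast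
    have "c \<le> 2 * p - 1" "2 * p - 1 \<le> c + r c" "1 \<le> c" "c \<le> 2 * n + 1" using c p by auto
    then have odd: "2 * p - 1 < 2 * c" "reflects w c (2 * p - 1)" using r by blast+
    show False
    proof (cases "c = p")
      \<comment> \<open>The palindrome is a prefix and excludes only \<open>y 0 = 0\<close>, which
        differs from \<open>w p\<close> anyway.\<close>
      case True
      then show ?thesis using c w y0 by simp
    next
      case False
      then have cp: "p < c" using odd by linarith
      have eq: "w p = w (c - p)"
        using before[of "c - p"] c cp by auto
      \<comment> \<open>Equal new ends would lengthen the palindrome beyond its radius
        \<open>r c\<close>.\<close>
      have "reflects w c (Suc (2 * p - 1))"
        by (subst reflects_Suc) (use c cp odd eq p in auto)
      then have "2 * p \<le> c + r c" using r[of c "2 * p"] c cp p by simp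
      then show ?thesis using c by simp
    qed
  qed
  ultimately show ?thesis using w by (auto intro: Least_le)
qed

lemma greedy_lex_least:
  assumes len: "length MP = 2 * n + 1" and reg: "regular_array MP"
    and y0: "y 0 = 0" and g: "\<And>p. 1 \<le> p \<Longrightarrow> p \<le> n \<Longrightarrow> greedy_at (nth1 MP) y p"
  shows "lex_least (string_of y n) (scope1_solutions MP)"
proof -
  let ?x = "string_of y n"
  obtain u :: "nat letter list" where u: "scope1 u" "max_pal_array (star u) = MP"
    using regular_array_scope1_solution[OF reg] .
  have ge1: "1 \<le> y p" if "1 \<le> p" "p \<le> n" for p
    using greedy_ge_1[OF _ g that] scope1_solution_radius(3)[OF u len] by blast
  have "\<forall>A\<in>set ?x. A \<subseteq> {1..}"
    using ge1 by (auto simp: string_of_def simp del: upt_Suc)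
  then have sol: "?x \<in> scope1_solutions MP"
    using greedy_solution[OF len u g] by (simp add: scope1_solutions_def string_of_simps)
  have "(chars ?x, chars v) \<in> lexord less_than"
    if v: "v \<in> scope1_solutions MP" and "?x \<noteq> v" for v
  proof -
    have v1: "scope1 v" "max_pal_array (star v) = MP" and pos: "\<forall>A\<in>set v. A \<subseteq> {1..}"
      using v by (auto simp: scope1_solutions_def)
    note rad = scope1_solution_radius[OF v1 len]
    have lv: "length v = n" by (rule rad(1))
    have sing: "v ! (p - 1) = {char_at v p}" if "1 \<le> p" "p \<le> n" for p
    proof -
      have "is_singleton (v ! (p - 1))" using v1 lv that by (auto simp: scope1_def)
      then show ?thesis unfolding char_at_def nth1_def by (rule is_singleton_the_elem[THEN iffD1])
    qed
    have v_ge1: "1 \<le> char_at v p" if "1 \<le> p" "p \<le> n" for p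
    proof -
      have "v ! (p - 1) \<in> set v" using that lv by simp
      then show ?thesis using sing[OF that] pos by auto
    qed
    have "\<exists>p. 1 \<le> p \<and> p \<le> n \<and> char_at v p \<noteq> y p"
    proof (rule ccontr)
      assume "\<not> ?thesis"
      then have "?x ! i = v ! i" if "i < n" for i
        using sing[of "Suc i"] that by (simp add: string_of_def del: upt_Suc)
      then show False using \<open>?x \<noteq> v\<close> lv by (auto intro: nth_equalityI simp: string_of_simps)
    qed
    \<comment> \<open>At the first difference \<open>greedy_minimal\<close> applies, because
      \<open>v\<close> agrees with \<open>y\<close> before it.\<close>
    then obtain p where p: "1 \<le> p" "p \<le> n" "char_at v p \<noteq> y p"
      and before: "\<And>q. q < p \<Longrightarrow> \<not> (1 \<le> q \<and> q \<le> n \<and> char_at v q \<noteq> y q)"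
      using exists_least_iff[of "\<lambda>p. 1 \<le> p \<and> p \<le> n \<and> char_at v p \<noteq> y p"] by blast
    have "y p \<le> char_at v p"
      by (rule greedy_minimal[OF rad(3) v_ge1[OF p(1,2)] p(1,2) y0 g[OF p(1,2)]])
        (use before p in auto)
    with p have less: "y p < char_at v p" by simp
    have cv: "chars v ! i = char_at v (Suc i)" if "i < n" for i
      using that lv by (simp add: chars_def char_at_def nth1_def)
    have cx: "chars ?x ! i = y (Suc i)" if "i < n" for i
      using that by (simp add: string_of_simps del: upt_Suc)
    have lens: "length (chars v) = n" "length (chars ?x) = n"
      by (simp_all add: chars_def lv string_of_simps)
    have "take (p - 1) (chars ?x) = take (p - 1) (chars v)"
      using p before by (intro nth_equalityI) (auto simp: lens cv cx)
    moreover have "(chars ?x ! (p - 1), chars v ! (p - 1)) \<in> less_than"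
      using p less cv[of "p - 1"] cx[of "p - 1"] by auto
    ultimately show "(chars ?x, chars v) \<in> lexord less_than"
      using p lens unfolding lexord_take_index_conv
      by (intro disjI2 exI[of _ "p - 1"]) auto
  qed
  with sol show ?thesis unfolding lex_least_def by blast
qed

section \<open>The program\<close>

text \<open>
  Register 2 holds \<open>p\<close>, register 3 holds \<open>2 * p\<close>, register 4 the centre \<open>c\<close>, register 8 the
  character under consideration. Registers 5 and 6 hold \<open>2 * n + 2\<close> and \<open>4 * n + 3\<close>, the base
  addresses of the computed string and of the stamps. Entry points: 5 next position,
  7 inspect \<open>c\<close>, 15 reject \<open>c\<close>, 21 least unstamped character, 28 write the character,
  32 move the string to the cells \<open>1..n\<close>.
\<close>

definition prog :: "instr list" where
  "prog =
    [Const 1 1, Copy 2 1, Copy 4 1, Add 5 0 1, Add 6 0 5,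
     Add 3 2 2, JumpLess 0 3 32,
     JumpEq 4 3 21, Load 7 4, Add 7 7 4, Sub 8 4 2, Add 8 8 5, Load 8 8,
     JumpLess 7 3 15, Jump 28,
     Add 7 7 1, JumpLess 7 3 19, Add 8 8 6, Store 8 3,
     Add 4 4 1, Jump 7,
     Copy 8 1, Add 7 8 6, Load 7 7, JumpEq 7 3 26, Jump 28,
     Add 8 8 1, Jump 22,
     Add 7 2 5, Store 7 8, Add 2 2 1, Jump 5,
     Sub 0 2 1, Copy 4 1,
     JumpEq 4 2 40, Add 7 4 5, Load 7 7, Store 4 7, Add 4 4 1, Jump 34]"

section \<open>Symbolic execution of the program\<close>

lemma step_prog:
  "pc < 40 \<Longrightarrow> step w prog (pc, R, M) = exec w (prog ! pc) (pc, R, M)"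
  by (simp add: step_def halted_def prog_def)

text \<open>Peeling off the first step lets the simplifier run the program forwards from an explicit
  configuration.\<close>

lemma funpow_numeral_step: "(f ^^ numeral k) x = (f ^^ pred_numeral k) (f x)"
  by (simp add: numeral_eq_Suc funpow_swap1)

lemma funpow_Suc_step: "(f ^^ Suc k) x = (f ^^ k) (f x)"
  by (simp add: funpow_swap1)

text \<open>\<open>prog\<close> is unfolded only where an instruction is fetched, so
  \<open>step w prog\<close> stays folded.\<close>

lemmas prog_nth = arg_cong[OF prog_def, of "\<lambda>P. P ! pc" for pc]

lemmas run_simps = funpow_numeral_step funpow_Suc_step step_prog prog_nth

text \<open>The largest numbers formed are stamp addresses \<open>4 * n + 3 + v\<close> with
  \<open>v \<le> 2 * n\<close>, so with this word size no addition wraps.\<close>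

locale word_ram_run =
  fixes n w :: nat and MP :: "nat list"
  assumes length_MP: "length MP = 2 * n + 1"
    and radius: "\<And>c. 1 \<le> c \<Longrightarrow> c \<le> 2 * n + 1 \<Longrightarrow> nth1 MP c < c \<and> c + nth1 MP c \<le> 2 * n + 1"
    and word_size: "8 * (n + 1) \<le> 2 ^ w"
begin

lemma mod_word [simp]: "a \<le> 8 * n + 7 \<Longrightarrow> a mod 2 ^ w = a"
  using word_size by simp

lemma word_pos [simp]: "0 < w"
  using word_size by (cases w) auto

text \<open>The step counts here and in the following lemmas are the lengths of the paths between
  entry points of the program.\<close>

lemma scan_covered:
  assumes "R 2 = p" "R 3 = 2 * p" "R 4 = c" "R 5 = 2 * n + 2" "c < 2 * p" "p \<le> n"
    and "M c = r" "c + r \<le> 2 * n + 1" "2 * p \<le> c + r"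
  shows "\<exists>R'. (step w prog ^^ 8) (7, R, M) = (28, R', M) \<and>
    R' 8 = M (2 * n + 2 + (c - p)) \<and> (\<forall>s. s \<noteq> 7 \<and> s \<noteq> 8 \<longrightarrow> R' s = R s)"
  using assms by (simp add: run_simps add.commute)


lemma scan_skip:
  assumes "R 1 = 1" "R 2 = p" "R 3 = 2 * p" "R 4 = c" "R 5 = 2 * n + 2" "c < 2 * p" "p \<le> n"
    and "M c = r" "c + r + 1 < 2 * p"
  shows "\<exists>R'. (step w prog ^^ 11) (7, R, M) = (7, R', M) \<and>
    R' 4 = c + 1 \<and> (\<forall>s. s \<noteq> 4 \<and> s \<noteq> 7 \<and> s \<noteq> 8 \<longrightarrow> R' s = R s)"
  using assms by (simp add: run_simps)

lemma scan_mark: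
  assumes "R 1 = 1" "R 2 = p" "R 3 = 2 * p" "R 4 = c" "R 5 = 2 * n + 2" "R 6 = 4 * n + 3"
    and "c < 2 * p" "p \<le> n"
    and "M c = r" "c + r + 1 = 2 * p" "M (2 * n + 2 + (c - p)) = v" "v \<le> 2 * n"
  shows "\<exists>R'. (step w prog ^^ 13) (7, R, M) = (7, R', M(4 * n + 3 + v := 2 * p)) \<and>
    R' 4 = c + 1 \<and> (\<forall>s. s \<noteq> 4 \<and> s \<noteq> 7 \<and> s \<noteq> 8 \<longrightarrow> R' s = R s)"
  using assms by (simp add: run_simps add.commute)

lemma scan_exhausted:
  assumes "R 1 = 1" "R 3 = 2 * p" "R 4 = 2 * p"
  shows "\<exists>R'. (step w prog ^^ 2) (7, R, M) = (22, R', M) \<and> R' 8 = 1 \<and>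
    (\<forall>s. s \<noteq> 8 \<longrightarrow> R' s = R s)"
  using assms by (simp add: run_simps)

lemma mex_next:
  assumes "R 1 = 1" "R 3 = 2 * p" "R 6 = 4 * n + 3" "R 8 = v" "v \<le> 2 * n" "M (4 * n + 3 + v) = 2 * p"
  shows "\<exists>R'. (step w prog ^^ 5) (22, R, M) = (22, R', M) \<and> R' 8 = v + 1 \<and>
    (\<forall>s. s \<noteq> 7 \<and> s \<noteq> 8 \<longrightarrow> R' s = R s)"
  using assms by (simp add: run_simps add.commute)

lemma mex_found:
  assumes "R 3 = 2 * p" "R 6 = 4 * n + 3" "R 8 = v" "v \<le> 2 * n" "M (4 * n + 3 + v) \<noteq> 2 * p"
  shows "\<exists>R'. (step w prog ^^ 4) (22, R, M) = (28, R', M) \<and>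
    (\<forall>s. s \<noteq> 7 \<longrightarrow> R' s = R s)"
  using assms by (simp add: run_simps add.commute)

lemma write_char:
  assumes "R 1 = 1" "R 2 = p" "R 5 = 2 * n + 2" "R 8 = v" "p \<le> n"
  shows "\<exists>R'. (step w prog ^^ 4) (28, R, M) = (5, R', M(2 * n + 2 + p := v)) \<and> R' 2 = p + 1 \<and>
    (\<forall>s. s \<noteq> 2 \<and> s \<noteq> 7 \<longrightarrow> R' s = R s)"
  using assms by (simp add: run_simps add.commute)

lemma outer_next:
  assumes "R 0 = 2 * n + 1" "R 2 = p" "p \<le> n"
  shows "\<exists>R'. (step w prog ^^ 2) (5, R, M) = (7, R', M) \<and> R' 3 = 2 * p \<and>
    (\<forall>s. s \<noteq> 3 \<longrightarrow> R' s = R s)"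
  using assms by (simp add: run_simps)

lemma outer_done:
  assumes "R 0 = 2 * n + 1" "R 1 = 1" "R 2 = n + 1"
  shows "\<exists>R'. (step w prog ^^ 4) (5, R, M) = (34, R', M) \<and> R' 0 = n \<and> R' 4 = 1 \<and>
    (\<forall>s. s \<noteq> 0 \<and> s \<noteq> 3 \<and> s \<noteq> 4 \<longrightarrow> R' s = R s)"
  using assms by (simp add: run_simps)

lemma copy_next:
  assumes "R 1 = 1" "R 2 = n + 1" "R 4 = q" "R 5 = 2 * n + 2" "q \<le> n"
  shows "\<exists>R'. (step w prog ^^ 6) (34, R, M) = (34, R', M(q := M (2 * n + 2 + q))) \<and> R' 4 = q + 1 \<and>
    (\<forall>s. s \<noteq> 4 \<and> s \<noteq> 7 \<longrightarrow> R' s = R s)"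
  using assms by (simp add: run_simps add.commute)

lemma copy_done:
  assumes "R 2 = n + 1" "R 4 = n + 1"
  shows "(step w prog ^^ 1) (34, R, M) = (40, R, M)"
  using assms by (simp add: run_simps)

lemma start:
  assumes "R 0 = 2 * n + 1"
  shows "\<exists>R'. (step w prog ^^ 5) (0, R, M) = (5, R', M) \<and> R' 0 = 2 * n + 1 \<and> R' 1 = 1 \<and> R' 2 = 1 \<and>
    R' 4 = 1 \<and> R' 5 = 2 * n + 2 \<and> R' 6 = 4 * n + 3"
  using assms by (simp add: run_simps)


section \<open>Loop invariants\<close>

text \<open>The cell \<open>2 * n + 2\<close> just past the input keeps its initial 0 and supplies
  \<open>y 0 = 0\<close>.\<close>

abbreviation (input) out :: "(nat \<Rightarrow> nat) \<Rightarrow> nat \<Rightarrow> nat" where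
  "out M j \<equiv> M (2 * n + 2 + j)"

abbreviation (input) stamp :: "(nat \<Rightarrow> nat) \<Rightarrow> nat \<Rightarrow> nat" where
  "stamp M v \<equiv> M (4 * n + 3 + v)"

definition regs :: "nat \<Rightarrow> nat \<Rightarrow> (nat \<Rightarrow> nat) \<Rightarrow> bool" where
  "regs p c R \<longleftrightarrow> R 0 = 2 * n + 1 \<and> R 1 = 1 \<and> R 2 = p \<and> R 4 = c \<and> R 5 = 2 * n + 2 \<and> R 6 = 4 * n + 3"

text \<open>The bound \<open>2 * n\<close> on the characters keeps the stamp addresses within a
  word.\<close>

definition mem :: "nat \<Rightarrow> (nat \<Rightarrow> nat) \<Rightarrow> bool" where
  "mem p M \<longleftrightarrow> (\<forall>a\<in>{1..2 * n + 1}. M a = nth1 MP a) \<and> out M 0 = 0 \<and>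
     (\<forall>q\<in>{1..<p}. greedy_at (nth1 MP) (out M) q \<and> out M q \<le> 2 * n)"

text \<open>Palindromes centred before \<open>c\<close> end too early to cover \<open>p\<close> or
  to exclude a character there, and all stamps are older than \<open>2 * p\<close>. So the scan
  resumes at \<open>c\<close> and no stamp needs clearing.\<close>

definition outer_inv :: "nat \<Rightarrow> nat \<Rightarrow> config \<Rightarrow> bool" where
  "outer_inv p c = (\<lambda>(pc, R, M). pc = 5 \<and> regs p c R \<and> mem p M \<and>
     1 \<le> p \<and> p \<le> n + 1 \<and> 1 \<le> c \<and> c \<le> 2 * p \<and>
     (\<forall>d\<in>{1..<c}. d + nth1 MP d + 1 < 2 * p) \<and> (\<forall>v. stamp M v < 2 * p))"

text \<open>The scan for \<open>p\<close> began at \<open>c0\<close>. Current stamps come only from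
  centres in \<open>{c0..<c}\<close>, so the advance of the centre bounds their number.\<close>

definition scan_inv :: "nat \<Rightarrow> nat \<Rightarrow> nat \<Rightarrow> (nat \<Rightarrow> nat) \<Rightarrow> (nat \<Rightarrow> nat) \<Rightarrow> bool" where
  "scan_inv p c0 c R M \<longleftrightarrow> regs p c R \<and> R 3 = 2 * p \<and> mem p M \<and>
     1 \<le> p \<and> p \<le> n \<and> 1 \<le> c0 \<and> c0 \<le> c \<and> c \<le> 2 * p \<and>
     (\<forall>d\<in>{1..<c}. d + nth1 MP d < 2 * p) \<and> (\<forall>d\<in>{1..<c0}. d + nth1 MP d + 1 < 2 * p) \<and>
     (\<forall>v. stamp M v \<le> 2 * p) \<and>
     (\<forall>v. stamp M v = 2 * p \<longleftrightarrow> (\<exists>d\<in>{1..<c}. d + nth1 MP d + 1 = 2 * p \<and> v = out M (d - p)))"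

definition write_inv :: "nat \<Rightarrow> nat \<Rightarrow> config \<Rightarrow> bool" where
  "write_inv p c = (\<lambda>(pc, R, M). pc = 28 \<and> regs p c R \<and> mem p M \<and>
     1 \<le> p \<and> p \<le> n \<and> 1 \<le> c \<and> c \<le> 2 * p \<and> R 8 \<le> 2 * n \<and>
     greedy_at (nth1 MP) ((out M)(p := R 8)) p \<and>
     (\<forall>d\<in>{1..<c}. d + nth1 MP d < 2 * p) \<and> (\<forall>v. stamp M v \<le> 2 * p))"

section \<open>Preservation of the invariants and the cost of one position\<close>

lemma scan_invD:
  assumes "scan_inv p c0 c R M"
  shows "regs p c R" "R 3 = 2 * p" "mem p M" "1 \<le> p" "p \<le> n" "1 \<le> c0" "c0 \<le> c" "c \<le> 2 * p"
    "\<forall>d\<in>{1..<c}. d + nth1 MP d < 2 * p" "\<forall>d\<in>{1..<c0}. d + nth1 MP d + 1 < 2 * p"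
    "\<forall>v. stamp M v \<le> 2 * p"
  by (insert assms[unfolded scan_inv_def], (elim conjE, assumption)+)

lemma scan_inv_stamp:
  assumes "scan_inv p c0 c R M"
  shows "stamp M v = 2 * p \<longleftrightarrow> (\<exists>d\<in>{1..<c}. d + nth1 MP d + 1 = 2 * p \<and> v = out M (d - p))"
  by (insert assms[unfolded scan_inv_def], elim conjE, erule spec)

lemma scan_inv_regs:
  assumes "scan_inv p c0 c R M" "\<And>s. s \<le> 6 \<Longrightarrow> R' s = R s"
  shows "scan_inv p c0 c R' M"
proof -
  have "regs p c R' = regs p c R" "R' 3 = R 3" using assms(2) by (simp_all add: regs_def)
  then have "scan_inv p c0 c R' M = scan_inv p c0 c R M" unfolding scan_inv_def by (simp only:)
  then show ?thesis using assms(1) by simp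
qed

lemma out_le: "mem p M \<Longrightarrow> j < p \<Longrightarrow> out M j \<le> 2 * n"
  unfolding mem_def by (cases "j = 0") auto

lemma input_cell: "mem p M \<Longrightarrow> 1 \<le> c \<Longrightarrow> c \<le> 2 * n + 1 \<Longrightarrow> M c = nth1 MP c"
  unfolding mem_def by auto

lemma mem_stamp: "mem p M \<Longrightarrow> p \<le> n + 1 \<Longrightarrow> mem p (M(4 * n + 3 + v := s))"
proof -
  assume *: "mem p M" "p \<le> n + 1"
  have "greedy_at (nth1 MP) (out (M(4 * n + 3 + v := s))) q" if "q \<in> {1..<p}" for q
  proof -
    have "greedy_at (nth1 MP) (out M) q" using * that by (auto simp: mem_def)
    then show ?thesis
      by (rule greedy_at_cong[THEN iffD1, rotated]) (use * that in auto)
  qed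
  then show ?thesis using * by (auto simp: mem_def)
qed

text \<open>If \<open>1..v - 1\<close> are all stamped, they come from different centres in
  \<open>{c0..<2 * p}\<close>. Hence the search advances at most \<open>2 * p - c0\<close> times, at
  5 steps each and 4 for the final test, and the character found is at most
  \<open>2 * n\<close>.\<close>

lemma scan_mex:
  assumes "scan_inv p c0 (2 * p) R M" "R 8 = v" "1 \<le> v" "\<forall>u\<in>{1..<v}. stamp M u = 2 * p"
  shows "\<exists>k. write_inv p (2 * p) ((step w prog ^^ k) (22, R, M)) \<and>
    k \<le> 5 * (2 * p + 1 - c0 - v) + 4"
  using assms
proof (induction "2 * p + 1 - v" arbitrary: v R rule: less_induct)
  case less
  note inv = scan_invD[OF less.prems(1)] and stamp_iff = scan_inv_stamp[OF less.prems(1)]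
  have le: "v \<le> 2 * p + 1 - c0" if "\<forall>u\<in>{1..<v}. stamp M u = 2 * p" for v
  proof -
    have "{1..<v} \<subseteq> (\<lambda>d. out M (d - p)) ` {c0..<2 * p}"
    proof
      fix u assume "u \<in> {1..<v}"
      then have "stamp M u = 2 * p" using that by blast
      then obtain d where d: "d \<in> {1..<2 * p}" "d + nth1 MP d + 1 = 2 * p" "u = out M (d - p)"
        unfolding stamp_iff by blast
      have "\<not> d < c0" using bspec[OF inv(10), of d] d(1,2) by auto
      then have "c0 \<le> d" by simp
      then show "u \<in> (\<lambda>d. out M (d - p)) ` {c0..<2 * p}" using d by auto
    qed
    then have "card {1..<v} \<le> card {c0..<2 * p}"
      by (intro surj_card_le finite_atLeastLessThan)
    then show ?thesis using inv(7) by auto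
  qed
  have v: "v \<le> 2 * p + 1 - c0" "v \<le> 2 * n" using le[OF less.prems(4)] inv(5,6) by auto
  show ?case
  proof (cases "stamp M v = 2 * p")
    case True
    have next_le: "v + 1 \<le> 2 * p + 1 - c0"
      by (rule le) (use True less.prems(4) in \<open>auto simp: less_Suc_eq\<close>)
    obtain R' where R': "(step w prog ^^ 5) (22, R, M) = (22, R', M)" "R' 8 = v + 1"
        "\<forall>s. s \<noteq> 7 \<and> s \<noteq> 8 \<longrightarrow> R' s = R s"
      using mex_next[of R p v M] inv(1,2) less.prems(2) v True by (auto simp: regs_def)
    have inv': "scan_inv p c0 (2 * p) R' M"
      using less.prems(1) by (rule scan_inv_regs) (use R'(3) in simp_all)
    have "\<exists>k. write_inv p (2 * p) ((step w prog ^^ k) (22, R', M)) \<and>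
        k \<le> 5 * (2 * p + 1 - c0 - (v + 1)) + 4"
    proof (rule less.hyps[OF _ inv' R'(2)])
      show "2 * p + 1 - (v + 1) < 2 * p + 1 - v" using v less.prems(3) inv(6) next_le by linarith
      show "\<forall>u\<in>{1..<v + 1}. stamp M u = 2 * p"
        using less.prems(4) True by (auto simp: less_Suc_eq)
    qed simp
    then obtain k where k: "write_inv p (2 * p) ((step w prog ^^ k) (22, R', M))"
        "k \<le> 5 * (2 * p + 1 - c0 - (v + 1)) + 4"
      by blast
    show ?thesis
    proof (intro exI conjI)
      show "write_inv p (2 * p) ((step w prog ^^ (k + 5)) (22, R, M))"
        using k(1) by (simp only: funpow_add comp_apply R'(1))
      show "k + 5 \<le> 5 * (2 * p + 1 - c0 - v) + 4" using k(2) next_le by linarith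
    qed
  next
    case False
    obtain R' where R': "(step w prog ^^ 4) (22, R, M) = (28, R', M)" "\<forall>s. s \<noteq> 7 \<longrightarrow> R' s = R s"
      using mex_found[of R p v M] inv(1,2) less.prems(2) v False by (auto simp: regs_def)
    let ?F = "{out M (d - p) |d. d \<in> {1..<2 * p} \<and> d + nth1 MP d + 1 = 2 * p}"
    have F: "u \<in> ?F \<longleftrightarrow> stamp M u = 2 * p" for u
      unfolding stamp_iff by blast
    have "(LEAST u. 1 \<le> u \<and> u \<notin> ?F) = v"
    proof (rule Least_equality)
      show "1 \<le> v \<and> v \<notin> ?F" using F False less.prems(3) by blast
      show "v \<le> u" if "1 \<le> u \<and> u \<notin> ?F" for u
      proof (rule ccontr)
        assume "\<not> v \<le> u"
        then have "u \<in> {1..<v}" using that by simp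
        then have "stamp M u = 2 * p" using less.prems(4) by blast
        then show False using that F by blast
      qed
    qed
    \<comment> \<open>The exclusion set reads only indices \<open>d - p < p\<close>, so writing at
      \<open>p\<close> leaves it unchanged.\<close>
    moreover have "{((out M)(p := v)) (d - p) |d. d \<in> {1..<2 * p} \<and> d + nth1 MP d + 1 = 2 * p} = ?F"
      by (intro Collect_cong ex_cong1) auto
    ultimately have "((out M)(p := v)) p = (LEAST u. 1 \<le> u \<and> u \<notin>
        {((out M)(p := v)) (d - p) |d. d \<in> {1..<2 * p} \<and> d + nth1 MP d + 1 = 2 * p})"
      by (simp only: fun_upd_same)
    then have "greedy_at (nth1 MP) ((out M)(p := v)) p"
      unfolding greedy_at_def using inv(9) by (intro disjI2 conjI)
    then have "write_inv p (2 * p) (28, R', M)"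
      using inv(1,3-6,8,9,11) R'(2) less.prems(2) v by (simp add: write_inv_def regs_def)
    then show ?thesis using R' by (intro exI[of _ 4]) auto
  qed
qed

lemma scan_inv_skip:
  assumes inv: "scan_inv p c0 c R M" and c: "c < 2 * p" "c + nth1 MP c + 1 < 2 * p"
    and R': "R' 4 = c + 1" "\<And>s. s \<le> 6 \<Longrightarrow> s \<noteq> 4 \<Longrightarrow> R' s = R s"
  shows "scan_inv p c0 (c + 1) R' M"
proof -
  note i = scan_invD[OF inv]
  have "regs p (c + 1) R'" "R' 3 = 2 * p" using i(1,2) R' by (simp_all add: regs_def)
  moreover have S: "{1..<c + 1} = insert c {1..<c}" using i(6,7) by auto
  moreover have "\<forall>d\<in>{1..<c + 1}. d + nth1 MP d < 2 * p"
    unfolding S using i(9) c(2) by simp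
  moreover have "stamp M v = 2 * p \<longleftrightarrow>
      (\<exists>d\<in>{1..<c + 1}. d + nth1 MP d + 1 = 2 * p \<and> v = out M (d - p))" for v
    unfolding S scan_inv_stamp[OF inv] using c(2) by simp
  ultimately show ?thesis
    unfolding scan_inv_def using i(3-8,10,11) c(1) by simp
qed

lemma scan_inv_mark:
  assumes inv: "scan_inv p c0 c R M" and c: "c < 2 * p" "c + nth1 MP c + 1 = 2 * p"
    and R': "R' 4 = c + 1" "\<And>s. s \<le> 6 \<Longrightarrow> s \<noteq> 4 \<Longrightarrow> R' s = R s"
    and M': "M' = M(4 * n + 3 + out M (c - p) := 2 * p)"
  shows "scan_inv p c0 (c + 1) R' M'"
proof -
  note i = scan_invD[OF inv]
  have r: "regs p (c + 1) R'" "R' 3 = 2 * p" using i(1,2) R' by (simp_all add: regs_def)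
  have m: "mem p M'" unfolding M' by (rule mem_stamp) (use i(3,5) in auto)
  have S: "{1..<c + 1} = insert c {1..<c}" using i(6,7) by auto
  have d: "\<forall>d\<in>{1..<c + 1}. d + nth1 MP d < 2 * p"
    unfolding S using i(9) c(2) by simp
  have out: "out M' (d - p) = out M (d - p)" if "d < 2 * p" for d
  proof -
    \<comment> \<open>The cells read lie below \<open>3 * n + 2\<close>, hence below the base of the
      stamps.\<close>
    have "2 * n + 2 + (d - p) \<noteq> 4 * n + 3 + out M (c - p)" using that i(5) by linarith
    then show ?thesis unfolding M' by (rule fun_upd_other)
  qed
  have "stamp M' v = 2 * p \<longleftrightarrow>
      (\<exists>d\<in>{1..<c + 1}. d + nth1 MP d + 1 = 2 * p \<and> v = out M' (d - p))" for v
  proof -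
    have "stamp M' v = 2 * p \<longleftrightarrow> v = out M (c - p) \<or> stamp M v = 2 * p"
      unfolding M' by simp
    also have "\<dots> \<longleftrightarrow> (\<exists>d\<in>{1..<c + 1}. d + nth1 MP d + 1 = 2 * p \<and> v = out M (d - p))"
      unfolding S scan_inv_stamp[OF inv] using c(2) by simp
    also have "\<dots> \<longleftrightarrow> (\<exists>d\<in>{1..<c + 1}. d + nth1 MP d + 1 = 2 * p \<and> v = out M' (d - p))"
      by (intro bex_cong refl conj_cong) (use out c(1) in auto)
    finally show ?thesis .
  qed
  moreover have "stamp M' v \<le> 2 * p" for v
    using i(11) by (simp add: M')
  ultimately show ?thesis
    unfolding scan_inv_def using r m d i(4-8,10) c(1) by simp
qed

text \<open>Passing a centre costs at most 13 steps. The term in \<open>c1 - c0\<close> pays for the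
  search of the least unstamped character, which runs only when \<open>c1 = 2 * p\<close>; 10 covers
  either exit.\<close>

lemma scan:
  assumes "scan_inv p c0 c R M"
  shows "\<exists>k c1. write_inv p c1 ((step w prog ^^ k) (7, R, M)) \<and> c \<le> c1 \<and>
    k \<le> 13 * (c1 - c) + 5 * (c1 - c0) + 10"
  using assms
proof (induction "2 * p - c" arbitrary: c R M rule: less_induct)
  case less
  note inv = scan_invD[OF less.prems]
  have continue: ?case
    if j: "(step w prog ^^ j) (7, R, M) = (7, R', M')" "j \<le> 13" and c: "c < 2 * p"
      and i': "scan_inv p c0 (c + 1) R' M'" for j R' M'
  proof -
    have "2 * p - (c + 1) < 2 * p - c" using c by linarith
    from less.hyps[OF this i'] obtain k c1 where
      k: "write_inv p c1 ((step w prog ^^ k) (7, R', M'))" "c + 1 \<le> c1"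
        "k \<le> 13 * (c1 - (c + 1)) + 5 * (c1 - c0) + 10" by blast
    have "write_inv p c1 ((step w prog ^^ (k + j)) (7, R, M))"
      using k(1) by (simp only: funpow_add comp_apply j(1))
    moreover have "k + j \<le> 13 * (c1 - c) + 5 * (c1 - c0) + 10" "c \<le> c1"
      using k(2,3) j(2) by linarith+
    ultimately show ?thesis by blast
  qed
  show ?case
  proof (cases "c = 2 * p")
    case True
    obtain R' where R': "(step w prog ^^ 2) (7, R, M) = (22, R', M)" "R' 8 = 1"
        "\<forall>s. s \<noteq> 8 \<longrightarrow> R' s = R s"
      using scan_exhausted[of R p M] inv(1,2) True by (auto simp: regs_def)
    have "scan_inv p c0 (2 * p) R' M"
      using less.prems unfolding True by (rule scan_inv_regs) (use R'(3) in simp)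
    from scan_mex[OF this R'(2)] obtain k where
      k: "write_inv p (2 * p) ((step w prog ^^ k) (22, R', M))" "k \<le> 5 * (2 * p + 1 - c0 - 1) + 4"
      by auto
    have "write_inv p (2 * p) ((step w prog ^^ (k + 2)) (7, R, M))"
      using k(1) by (simp only: funpow_add comp_apply R'(1))
    moreover have "k + 2 \<le> 13 * (2 * p - c) + 5 * (2 * p - c0) + 10" using k(2) by linarith
    ultimately show ?thesis using True by blast
  next
    case False
    then have c: "c < 2 * p" using inv(8) by simp
    have cm: "1 \<le> c" "c \<le> 2 * n + 1" using inv(5-7) c by auto
    have Mc: "M c = nth1 MP c" by (rule input_cell[OF inv(3) cm])
    note rc = radius[OF cm]
    have cp: "c - p < p" using c inv(4) by linarith
    \<comment> \<open>The palindrome covers \<open>p\<close>, or ends exactly at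
      \<open>2 * p - 1\<close> and excludes a character, or ends earlier.\<close>
    consider "2 * p \<le> c + nth1 MP c" | "c + nth1 MP c + 1 = 2 * p" | "c + nth1 MP c + 1 < 2 * p"
      by linarith
    then show ?thesis
    proof cases
      case 1
      obtain R' where R': "(step w prog ^^ 8) (7, R, M) = (28, R', M)" "R' 8 = out M (c - p)"
          "\<forall>s. s \<noteq> 7 \<and> s \<noteq> 8 \<longrightarrow> R' s = R s"
        using scan_covered[of R p c M "nth1 MP c"] inv(1,2,5) c Mc rc 1 by (auto simp: regs_def)
      have "greedy_at (nth1 MP) ((out M)(p := R' 8)) p"
        unfolding greedy_at_def using 1 c cm cp R'(2) by (intro disjI1 bexI[of _ c]) auto
      moreover have "R' 8 \<le> 2 * n" unfolding R'(2) by (rule out_le[OF inv(3) cp])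
      ultimately have "write_inv p c (28, R', M)"
        using inv(1,3-5,8,9,11) R'(3) cm by (simp add: write_inv_def regs_def)
      then have "write_inv p c ((step w prog ^^ 8) (7, R, M))" by (simp only: R'(1))
      then show ?thesis by (intro exI[of _ 8] exI[of _ c]) simp
    next
      case 2
      obtain R' where R': "(step w prog ^^ 13) (7, R, M) = (7, R', M(4 * n + 3 + out M (c - p) := 2 * p))"
          "R' 4 = c + 1" "\<forall>s. s \<noteq> 4 \<and> s \<noteq> 7 \<and> s \<noteq> 8 \<longrightarrow> R' s = R s"
        using scan_mark[of R p c M "nth1 MP c" "out M (c - p)"] inv(1,2,5) c Mc 2
          out_le[OF inv(3) cp] by (auto simp: regs_def)
      have "scan_inv p c0 (c + 1) R' (M(4 * n + 3 + out M (c - p) := 2 * p))"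
        by (rule scan_inv_mark[OF less.prems c 2]) (use R'(2,3) in simp_all)
      from continue[OF R'(1) _ c this] show ?thesis by simp
    next
      case 3
      obtain R' where R': "(step w prog ^^ 11) (7, R, M) = (7, R', M)"
          "R' 4 = c + 1" "\<forall>s. s \<noteq> 4 \<and> s \<noteq> 7 \<and> s \<noteq> 8 \<longrightarrow> R' s = R s"
        using scan_skip[of R p c M "nth1 MP c"] inv(1,2,5) c Mc 3 by (auto simp: regs_def)
      have "scan_inv p c0 (c + 1) R' M"
        by (rule scan_inv_skip[OF less.prems c 3]) (use R'(2,3) in simp_all)
      from continue[OF R'(1) _ c this] show ?thesis by simp
    qed
  qed
qed

text \<open>Passing to \<open>p + 1\<close> raises \<open>2 * p\<close> by two, so stamps up to
  \<open>2 * p\<close> become stale and centres that failed to reach \<open>2 * p\<close> drop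
  out.\<close>

lemma write_outer:
  assumes "write_inv p c conf"
  shows "outer_inv (p + 1) c ((step w prog ^^ 4) conf)"
proof -
  obtain R M where conf: "conf = (28, R, M)"
    using assms unfolding write_inv_def by (cases conf) auto
  have inv: "regs p c R" "mem p M" "1 \<le> p" "p \<le> n" "1 \<le> c" "c \<le> 2 * p" "R 8 \<le> 2 * n"
      "greedy_at (nth1 MP) ((out M)(p := R 8)) p"
      "\<forall>d\<in>{1..<c}. d + nth1 MP d < 2 * p" "\<forall>v. stamp M v \<le> 2 * p"
    by (insert assms[unfolded write_inv_def conf prod.case], (elim conjE, assumption)+)
  define M' where "M' = M(2 * n + 2 + p := R 8)"
  obtain R' where R': "(step w prog ^^ 4) (28, R, M) = (5, R', M')" "R' 2 = p + 1"
      "\<forall>s. s \<noteq> 2 \<and> s \<noteq> 7 \<longrightarrow> R' s = R s"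
    using write_char[of R p "R 8" M] inv(1,4) by (auto simp: regs_def M'_def)
  have out: "out M' = (out M)(p := R 8)" by (auto simp: M'_def)
  have "greedy_at (nth1 MP) (out M') q \<and> out M' q \<le> 2 * n" if q: "q \<in> {1..<p + 1}" for q
  proof (cases "q = p")
    case True
    have "out M' p = R 8" by (simp add: M'_def)
    then show ?thesis using inv(7,8) True unfolding out by simp
  next
    case False
    with q have "q \<in> {1..<p}" by simp
    then have "greedy_at (nth1 MP) (out M) q" "out M q \<le> 2 * n"
      using inv(2) unfolding mem_def by blast+
    moreover have "greedy_at (nth1 MP) (out M) q = greedy_at (nth1 MP) (out M') q"
      by (rule greedy_at_cong) (use \<open>q \<in> {1..<p}\<close> in \<open>auto simp: M'_def\<close>)
    ultimately show ?thesis using False by (simp add: M'_def)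
  qed
  moreover have "M' a = nth1 MP a" if "a \<in> {1..2 * n + 1}" for a
    using that input_cell[OF inv(2), of a] by (simp add: M'_def)
  moreover have "out M' 0 = 0"
    using inv(2,3) by (simp add: mem_def M'_def)
  ultimately have "mem (p + 1) M'" unfolding mem_def by blast
  moreover have "regs (p + 1) c R'" using inv(1) R'(2,3) by (simp add: regs_def)
  moreover have "stamp M' v < 2 * (p + 1)" for v
    using spec[OF inv(10), of v] inv(4) by (simp add: M'_def)
  moreover have "d + nth1 MP d + 1 < 2 * (p + 1)" if "d \<in> {1..<c}" for d
    using bspec[OF inv(9) that] by simp
  ultimately have "outer_inv (p + 1) c (5, R', M')"
    unfolding outer_inv_def using inv(4-6) by simp
  then show ?thesis unfolding conf R'(1) .
qed

section \<open>Amortised cost of the whole run\<close>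

lemma outer_step:
  assumes "outer_inv p c conf" "p \<le> n"
  shows "\<exists>k c1. outer_inv (p + 1) c1 ((step w prog ^^ k) conf) \<and> c \<le> c1 \<and> k \<le> 18 * (c1 - c) + 16"
proof -
  obtain R M where conf: "conf = (5, R, M)"
    using assms(1) unfolding outer_inv_def by (cases conf) auto
  have inv: "regs p c R" "mem p M" "1 \<le> p" "1 \<le> c" "c \<le> 2 * p"
      "\<forall>d\<in>{1..<c}. d + nth1 MP d + 1 < 2 * p" "\<forall>v. stamp M v < 2 * p"
    by (insert assms(1)[unfolded outer_inv_def conf prod.case], (elim conjE, assumption)+)
  obtain R' where R': "(step w prog ^^ 2) (5, R, M) = (7, R', M)" "R' 3 = 2 * p"
      "\<forall>s. s \<noteq> 3 \<longrightarrow> R' s = R s"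
    using outer_next[of R p M] inv(1) assms(2) by (auto simp: regs_def)
  have "stamp M v \<le> 2 * p" for v
    using spec[OF inv(7), of v] by simp
  \<comment> \<open>Both sides are false when a scan starts: no stamp is current, and no earlier
    centre reaches \<open>2 * p - 1\<close>.\<close>
  moreover have "stamp M v = 2 * p \<longleftrightarrow>
      (\<exists>d\<in>{1..<c}. d + nth1 MP d + 1 = 2 * p \<and> v = out M (d - p))" for v
    using spec[OF inv(7), of v] inv(6) by (metis less_irrefl)
  moreover have "d + nth1 MP d < 2 * p" if "d \<in> {1..<c}" for d
    using bspec[OF inv(6) that] by simp
  moreover have "regs p c R'" using inv(1) R'(3) by (simp add: regs_def)
  ultimately have "scan_inv p c c R' M"
    unfolding scan_inv_def using inv(2-6) assms(2) R'(2) by (intro conjI allI ballI) auto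
  from scan[OF this] obtain k c1 where
    k: "write_inv p c1 ((step w prog ^^ k) (7, R', M))" "c \<le> c1"
      "k \<le> 13 * (c1 - c) + 5 * (c1 - c) + 10" by blast
  have "outer_inv (p + 1) c1 ((step w prog ^^ (4 + (k + 2))) conf)"
    using write_outer[OF k(1)] unfolding conf by (simp only: funpow_add comp_apply R'(1))
  \<comment> \<open>Since \<open>c0 = c\<close>, 18 is 13 for scanning plus 5 for searching; 16 is 2
    to enter, 10 for the scan and 4 to write.\<close>
  moreover have "4 + (k + 2) \<le> 18 * (c1 - c) + 16" using k(3) by simp
  ultimately show ?thesis using k(2) by blast
qed

text \<open>The advances of \<open>c\<close> telescope, since the centre never moves back.\<close>

lemma outer_loop:
  assumes "outer_inv p c conf"
  shows "\<exists>k c1. outer_inv (n + 1) c1 ((step w prog ^^ k) conf) \<and> c \<le> c1 \<and>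
    k \<le> 18 * (c1 - c) + 16 * (n + 1 - p)"
  using assms
proof (induction "n + 1 - p" arbitrary: p c conf)
  case 0
  then have "p = n + 1" by (auto simp: outer_inv_def)
  then show ?case using 0 by (intro exI[of _ 0] exI[of _ c]) simp
next
  case (Suc i)
  then have "p \<le> n" by simp
  from outer_step[OF Suc.prems this] obtain k c1 where
    k: "outer_inv (p + 1) c1 ((step w prog ^^ k) conf)" "c \<le> c1" "k \<le> 18 * (c1 - c) + 16" by blast
  have "i = n + 1 - (p + 1)" using Suc.hyps(2) by simp
  from Suc.hyps(1)[OF this k(1)] obtain l c2 where
    l: "outer_inv (n + 1) c2 ((step w prog ^^ l) ((step w prog ^^ k) conf))" "c1 \<le> c2"
      "l \<le> 18 * (c2 - c1) + 16 * (n + 1 - (p + 1))" by blast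
  have "outer_inv (n + 1) c2 ((step w prog ^^ (l + k)) conf)"
    using l(1) by (simp only: funpow_add comp_apply)
  moreover have "l + k \<le> 18 * (c2 - c) + 16 * (n + 1 - p)"
    using k l \<open>p \<le> n\<close> by linarith
  ultimately show ?case using k(2) l(2) le_trans by blast
qed

text \<open>Targets \<open>q \<le> n\<close> lie below all sources \<open>2 * n + 2 + q\<close>, so
  no source is overwritten.\<close>

lemma copy_loop:
  assumes "R 1 = 1" "R 2 = n + 1" "R 4 = q" "R 5 = 2 * n + 2" "q \<le> n + 1"
  shows "\<exists>k R' M'. (step w prog ^^ k) (34, R, M) = (40, R', M') \<and> R' 0 = R 0 \<and>
    (\<forall>a\<in>{q..n}. M' a = out M a) \<and> (\<forall>a<q. M' a = M a) \<and> k \<le> 6 * (n + 1 - q) + 1"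
  using assms
proof (induction "n + 1 - q" arbitrary: q R M)
  case 0
  then have "R 4 = n + 1" "q = n + 1" by auto
  from copy_done[OF 0(3) this(1), of M] \<open>q = n + 1\<close>
  show ?case by (intro exI[of _ 1] exI[of _ R] exI[of _ M]) simp
next
  case (Suc i)
  then have q: "q \<le> n" by simp
  define M1 where "M1 = M(q := out M q)"
  obtain R1 where R1: "(step w prog ^^ 6) (34, R, M) = (34, R1, M1)" "R1 4 = q + 1"
      "\<forall>s. s \<noteq> 4 \<and> s \<noteq> 7 \<longrightarrow> R1 s = R s"
    using copy_next[OF Suc.prems(1-4) q, of M] unfolding M1_def by blast
  have "\<exists>k R' M'. (step w prog ^^ k) (34, R1, M1) = (40, R', M') \<and> R' 0 = R1 0 \<and>
    (\<forall>a\<in>{q + 1..n}. M' a = out M1 a) \<and> (\<forall>a<q + 1. M' a = M1 a) \<and> k \<le> 6 * (n + 1 - (q + 1)) + 1"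
    by (rule Suc.hyps(1)) (use Suc.hyps(2) Suc.prems R1(2,3) q in simp_all)
  then obtain k R' M' where k: "(step w prog ^^ k) (34, R1, M1) = (40, R', M')" "R' 0 = R1 0"
    "\<forall>a\<in>{q + 1..n}. M' a = out M1 a" "\<forall>a<q + 1. M' a = M1 a" "k \<le> 6 * (n + 1 - (q + 1)) + 1"
    by blast
  have "(step w prog ^^ (k + 6)) (34, R, M) = (40, R', M')"
    using k(1) by (simp only: funpow_add comp_apply R1(1))
  moreover have "M' a = out M a" if a: "a \<in> {q..n}" for a
  proof (cases "a = q")
    case True
    then show ?thesis using spec[OF k(4), of q] by (simp add: M1_def)
  next
    case False
    then show ?thesis using bspec[OF k(3), of a] a q by (simp add: M1_def)
  qed
  moreover have "M' a = M a" if "a < q" for a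
    using spec[OF k(4), of a] that by (simp add: M1_def)
  moreover have "k + 6 \<le> 6 * (n + 1 - q) + 1" "R' 0 = R 0" using k(2,5) R1(3) q by simp_all
  ultimately show ?case by blast
qed

lemma prog_outputs_greedy:
  "\<exists>y. y 0 = 0 \<and> (\<forall>p\<in>{1..n}. greedy_at (nth1 MP) y p) \<and>
     outputs_within w prog MP (map y [1..<n + 1]) (60 * n + 60)"
proof -
  obtain R0 M0 where init: "init_config MP = (0, R0, M0)" by (simp add: init_config_def)
  have R0: "R0 0 = 2 * n + 1" and M0: "M0 = (\<lambda>a. if a \<in> {1..2 * n + 1} then nth1 MP a else 0)"
    using init length_MP by (auto simp: init_config_def)
  obtain R where R: "(step w prog ^^ 5) (0, R0, M0) = (5, R, M0)" "R 0 = 2 * n + 1" "R 1 = 1"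
      "R 2 = 1" "R 4 = 1" "R 5 = 2 * n + 2" "R 6 = 4 * n + 3"
    using start[of R0 M0] R0 by blast
  have "outer_inv 1 1 (5, R, M0)"
    using R by (simp add: outer_inv_def regs_def mem_def M0)
  from outer_loop[OF this] obtain k c where
    k: "outer_inv (n + 1) c ((step w prog ^^ k) (5, R, M0))" "k \<le> 18 * (c - 1) + 16 * (n + 1 - 1)"
    by blast
  have "fst ((step w prog ^^ k) (5, R, M0)) = 5"
    using k(1) unfolding outer_inv_def case_prod_beta by (rule conjunct1)
  then obtain R1 M1 where R1: "(step w prog ^^ k) (5, R, M0) = (5, R1, M1)"
    by (metis prod.collapse)
  have inv: "regs (n + 1) c R1" "mem (n + 1) M1" "c \<le> 2 * (n + 1)"
    by (insert k(1)[unfolded R1 outer_inv_def prod.case], (elim conjE, assumption)+)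
  obtain R2 where R2: "(step w prog ^^ 4) (5, R1, M1) = (34, R2, M1)" "R2 0 = n" "R2 4 = 1"
      "\<forall>s. s \<noteq> 0 \<and> s \<noteq> 3 \<and> s \<noteq> 4 \<longrightarrow> R2 s = R1 s"
    using outer_done[of R1 M1] inv(1) by (auto simp: regs_def)
  have "R2 1 = 1" "R2 2 = n + 1" "R2 5 = 2 * n + 2"
    using inv(1) R2(4) by (simp_all add: regs_def)
  from copy_loop[OF this(1,2) R2(3) this(3), of M1] obtain l R3 M3 where
    l: "(step w prog ^^ l) (34, R2, M1) = (40, R3, M3)" "R3 0 = R2 0"
      "\<forall>a\<in>{1..n}. M3 a = out M1 a" "l \<le> 6 * (n + 1 - 1) + 1"
    using le_add2 by blast
  have run: "(step w prog ^^ (l + (4 + (k + 5)))) (init_config MP) = (40, R3, M3)"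
    unfolding init by (simp only: funpow_add comp_apply R(1) R1 R2(1) l(1))
  have out_nth: "nth1 (map (out M1) [1..<n + 1]) a = out M1 a" if "a \<in> {1..n}" for a
    using that by (auto simp: nth1_def simp del: upt_Suc)
  have "halted prog (40, R3, M3)" by (simp add: halted_def prog_def)
  moreover have "holds_output (40, R3, M3) (map (out M1) [1..<n + 1])"
    unfolding holds_output_def prod.case
  proof (intro conjI ballI)
    show "R3 0 = length (map (out M1) [1..<n + 1])" using l(2) R2(2) by (simp del: upt_Suc)
    fix a assume "a \<in> {1..length (map (out M1) [1..<n + 1])}"
    then have "a \<in> {1..n}" by (simp del: upt_Suc)
    then show "M3 a = nth1 (map (out M1) [1..<n + 1]) a" using l(3) out_nth by metis
  qed
  moreover have "l + (4 + (k + 5)) \<le> 60 * n + 60"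
  proof -
    \<comment> \<open>The centre never exceeds \<open>2 * n + 2\<close>, so the bounds add up to
      \<open>58 * n + 28\<close>.\<close>
    have "c - 1 \<le> 2 * n + 1" using inv(3) by simp
    then show ?thesis using k(2) l(4) by simp
  qed
  ultimately have "outputs_within w prog MP (map (out M1) [1..<n + 1]) (60 * n + 60)"
    unfolding outputs_within_def Let_def run[symmetric]
    by (intro exI[of _ "l + (4 + (k + 5))"] conjI)
  moreover have "out M1 0 = 0" using inv(2) unfolding mem_def by blast
  moreover have "greedy_at (nth1 MP) (out M1) p" if "p \<in> {1..n}" for p
  proof -
    have "p \<in> {1..<n + 1}" using that by simp
    then show ?thesis using inv(2) unfolding mem_def by blast
  qed
  ultimately show ?thesis by (intro exI[of _ "out M1"] conjI ballI)
qed

end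

theorem theorem2:
  "\<exists>(P :: instr list) (T :: nat \<Rightarrow> nat) (W :: nat).
     (\<lambda>n. real (T n)) \<in> O(\<lambda>n. real n) \<and>
     (\<forall>(n :: nat) (MP :: nat list) (w :: nat).
        length MP = 2 * n + 1 \<and> regular_array MP \<and> W * (n + 1) \<le> 2 ^ w \<longrightarrow>
        (\<exists>x. lex_least x (scope1_solutions MP) \<and> outputs_within w P MP (chars x) (T n)))"
proof (intro exI[of _ prog] exI[of _ "\<lambda>n. 60 * n + 60"] exI[of _ 8] conjI allI impI)
  show "(\<lambda>n. real (60 * n + 60)) \<in> O(\<lambda>n. real n)"
  proof (rule bigoI)
    show "\<forall>\<^sub>F n in sequentially. norm (real (60 * n + 60)) \<le> 120 * norm (real n)"
      using eventually_ge_at_top[of 1] by eventually_elim simp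
  qed
next
  fix n w :: nat and MP :: "nat list"
  assume *: "length MP = 2 * n + 1 \<and> regular_array MP \<and> 8 * (n + 1) \<le> 2 ^ w"
  then have reg: "regular_array MP" by simp
  obtain u :: "nat letter list" where u: "scope1 u" "max_pal_array (star u) = MP"
    using regular_array_scope1_solution[OF reg] .
  interpret word_ram_run n w MP
  proof
    \<comment> \<open>Taking as \<open>t\<close> the endpoint that the palindrome itself reaches
      gives both bounds.\<close>
    show "nth1 MP c < c \<and> c + nth1 MP c \<le> 2 * n + 1" if "1 \<le> c" "c \<le> 2 * n + 1" for c
      using scope1_solution_radius(3)[OF u, of n c "c + nth1 MP c"] * that by simp
  qed (use * in auto)
  obtain y where y: "y 0 = 0" "\<forall>p\<in>{1..n}. greedy_at (nth1 MP) y p"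
    "outputs_within w prog MP (map y [1..<n + 1]) (60 * n + 60)"
    using prog_outputs_greedy by blast
  have "lex_least (string_of y n) (scope1_solutions MP)"
    using greedy_lex_least[of MP n y] y(1,2) * by simp
  moreover have "outputs_within w prog MP (chars (string_of y n)) (60 * n + 60)"
    using y(3) by (simp only: string_of_simps)
  ultimately show "\<exists>x. lex_least x (scope1_solutions MP) \<and>
      outputs_within w prog MP (chars x) (60 * n + 60)" by blast
qed

end
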